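(* Let $n\ge 1$, $1<p\le 2$, and let $F\in C^{2,\beta}_{loc}(\mathbb{R})$ for some $\beta>0$, with $F\ge 0$; write $f=F'$. Let $g:\mathbb{R}^n\to\mathbb{R}$ be Lipschitz continuous with $\|g\|_{L^\infty(\mathbb{R}^n)}<\infty$ and $\|Dg\|_{L^\infty(\mathbb{R}^n)}<\infty$, and put $M=\|g\|_{L^\infty(\mathbb{R}^n)}$. Assume that there exist constants $q, M_1, M_2$ such that $$-q\le M_1\le -M,\qquad M\le M_2\le q,\qquad f(M_1)\le 0\le f(M_2),$$ and that $$|Dg(x)|^p\le \frac{p}{p-1}F(g(x))\quad\text{for a.e. } x\in\mathbb{R}^n.$$ Let $T>0$ and let $u$ be the unique viscosity solution in the class $H_T$ of the Cauchy problem $$|Du|^{2-p}\left\{\operatorname{div}(|Du|^{p-2}Du)-F'(u)\right\}=u_t\ \text{ in }\mathbb{R}^n\times(0,T),\qquad u(\cdot,0)=g.$$ If $F(u(x_0,t_0))=0$ for some point $(x_0,t_0)\in\mathbb{R}^n\times[0,T]$, then $u(\cdot,t_0)$ is constant on $\mathbb{R}^n$.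
   Context: $D$ denotes the gradient in the space variable $x$ (which exists a.e. for Lipschitz functions), and subscripts $i,j$ denote partial derivatives in $x$; repeated indices are summed. The class $H_T$: the set of all $u\in C(\mathbb{R}^n\times[0,T])$ such that $x\mapsto u(x,t)$ is Lipschitz continuous on $\mathbb{R}^n$ for each $t$, and $\|u\|_{L^\infty(\mathbb{R}^n\times[0,T])}<\infty$, $\|Du\|_{L^\infty(\mathbb{R}^n\times[0,T])}<\infty$. Under the stated hypotheses on $g$ and $F$, the Cauchy problem has exactly one viscosity solution in $H_T$. Viscosity solution: the equation is understood through its non-divergence form $$\left(\delta_{ij}+(p-2)\frac{u_iu_j}{|Du|^2}\right)u_{ij}=|Du|^{2-p}f(u)+u_t .$$ Convention: $|0|^{2-p}=0$ if $p<2$ and $|0|^{2-p}=1$ if $p=2$. A bounded continuous $u$ is a viscosity subsolution if, whenever $\phi\in C^2(\mathbb{R}^n\times(0,T))$ and $u-\phi$ has a local maximum at $z_0\in\mathbb{R}^n\times(0,T)$, then at $z_0$: (i) if $D\phi(z_0)\ne0$, $\ \phi_t+|D\phi|^{2-p}f(u)\le\left(\delta_{ij}+(p-2)\frac{\phi_i\phi_j}{|D\phi|^2}\right)\phi_{ij}$; (ii) if $D\phi(z_0)=0$, $\ \inf_{|a|=1}\left\{\phi_t+|D\phi|^{2-p}f(u)-(\delta_{ij}+(p-2)a_ia_j)\phi_{ij}\right\}\le 0$. A viscosity supersolution is defined symmetrically: local maximum is replaced by local minimum, the inequality in (i) is reversed, and in (ii) the condition becomes $\sup_{|a|=1}\{\dots\}\ge0$.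 A viscosity solution is both a subsolution and a supersolution. *)

theory Defs
  imports "HOL-Analysis.Analysis" "HOL-Probability.Essential_Supremum"
begin

(* An arbitrary dimension n >= 1 is represented by a finite index type 'n, so R^n is real ^ 'n.
   Space-time functions are functions on (real ^ 'n) \<times> real, the second component being
   time; only their values on the relevant strip matter. *)

definition partial_deriv :: "'a \<Rightarrow> ('a::real_normed_vector \<Rightarrow> real) \<Rightarrow> 'a \<Rightarrow> real" where
  "partial_deriv b v z = deriv (\<lambda>s. v (z + s *\<^sub>R b)) 0"

(* For Lipschitz v the partial derivatives exist almost everywhere; on the exceptional null set
   the components have an arbitrary fixed value (a property of the library constant deriv). *)
definition gradient :: "(real ^ 'n \<Rightarrow> real) \<Rightarrow> real ^ 'n \<Rightarrow> real ^ 'n" where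
  "gradient v x = (\<chi> i. partial_deriv (axis i 1) v x)"

definition space_gradient :: "((real ^ 'n) \<times> real \<Rightarrow> real) \<Rightarrow> (real ^ 'n) \<times> real \<Rightarrow> real ^ 'n" where
  "space_gradient v z = gradient (\<lambda>x. v (x, snd z)) (fst z)"

definition space_hessian ::
    "((real ^ 'n) \<times> real \<Rightarrow> real) \<Rightarrow> (real ^ 'n) \<times> real \<Rightarrow> real ^ 'n ^ 'n" where
  "space_hessian v z =
     (\<chi> i j. partial_deriv (axis j 1, 0) (partial_deriv (axis i 1, 0) v) z)"

definition time_deriv :: "((real ^ 'n) \<times> real \<Rightarrow> real) \<Rightarrow> (real ^ 'n) \<times> real \<Rightarrow> real" where
  "time_deriv v z = partial_deriv (0, 1) v z"

definition C1_on :: "'a set \<Rightarrow> ('a::euclidean_space \<Rightarrow> real) \<Rightarrow> bool" where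
  "C1_on S v \<longleftrightarrow> continuous_on S v \<and>
     (\<forall>b\<in>Basis. (\<forall>z\<in>S. (\<lambda>s::real. v (z + s *\<^sub>R b)) differentiable (at 0)) \<and>
                continuous_on S (partial_deriv b v))"

(* Intended for open S. *)
definition C2_on :: "'a set \<Rightarrow> ('a::euclidean_space \<Rightarrow> real) \<Rightarrow> bool" where
  "C2_on S v \<longleftrightarrow> C1_on S v \<and> (\<forall>b\<in>Basis. C1_on S (partial_deriv b v))"

(* The class C^{2,\<beta>}_loc(R); continuity of F'' follows from the Hoelder condition. *)
definition C2_holder_loc :: "real \<Rightarrow> (real \<Rightarrow> real) \<Rightarrow> bool" where
  "C2_holder_loc \<beta> F \<longleftrightarrow>
     (\<forall>r. F differentiable (at r)) \<and> (\<forall>r. deriv F differentiable (at r)) \<and>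
     (\<forall>K. compact K \<longrightarrow>
        (\<exists>C. \<forall>r\<in>K. \<forall>s\<in>K. \<bar>deriv (deriv F) r - deriv (deriv F) s\<bar> \<le> C * \<bar>r - s\<bar> powr \<beta>))"

definition Linfty_norm :: "'a measure \<Rightarrow> ('a \<Rightarrow> 'b::real_normed_vector) \<Rightarrow> ereal" where
  "Linfty_norm N v = esssup N (\<lambda>x. ereal (norm (v x)))"

definition class_H :: "real \<Rightarrow> ((real ^ 'n) \<times> real \<Rightarrow> real) set" where
  "class_H T = {u. continuous_on (UNIV \<times> {0..T}) u \<and>
     (\<forall>t\<in>{0..T}. \<exists>L. L-lipschitz_on UNIV (\<lambda>x. u (x, t))) \<and>
     Linfty_norm (lebesgue_on (UNIV \<times> {0..T})) u < \<infinity> \<and>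
     Linfty_norm (lebesgue_on (UNIV \<times> {0..T})) (space_gradient u) < \<infinity>}"

(* r^{2-p} with the convention 0^{2-p} = 0 if p < 2 and 0^{2-p} = 1 if p = 2. The case
   distinction is needed because 0 powr 0 = 0 in the library. *)
definition pow_two_minus :: "real \<Rightarrow> real \<Rightarrow> real" where
  "pow_two_minus p r = (if p = 2 then 1 else r powr (2 - p))"

definition local_max_at :: "'a::topological_space set \<Rightarrow> ('a \<Rightarrow> real) \<Rightarrow> 'a \<Rightarrow> bool" where
  "local_max_at S v z \<longleftrightarrow> z \<in> S \<and> (\<forall>\<^sub>F w in at z within S. v w \<le> v z)"

definition local_min_at :: "'a::topological_space set \<Rightarrow> ('a \<Rightarrow> real) \<Rightarrow> 'a \<Rightarrow> bool" where
  "local_min_at S v z \<longleftrightarrow> z \<in> S \<and> (\<forall>\<^sub>F w in at z within S. v z \<le> v w)"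

(* (\<delta>_ij + (p-2) \<phi>_i \<phi>_j / |D\<phi>|^2) \<phi>_ij *)
definition p_diffusion :: "real \<Rightarrow> ((real ^ 'n) \<times> real \<Rightarrow> real) \<Rightarrow> (real ^ 'n) \<times> real \<Rightarrow> real" where
  "p_diffusion p \<phi> z =
     (\<Sum>i\<in>UNIV. \<Sum>j\<in>UNIV.
        (of_bool (i = j) +
           (p - 2) * (space_gradient \<phi> z $ i * space_gradient \<phi> z $ j / (norm (space_gradient \<phi> z))\<^sup>2)) *
        space_hessian \<phi> z $ i $ j)"

(* (\<delta>_ij + (p-2) a_i a_j) \<phi>_ij *)
definition p_diffusion_dir ::
    "real \<Rightarrow> real ^ 'n \<Rightarrow> ((real ^ 'n) \<times> real \<Rightarrow> real) \<Rightarrow> (real ^ 'n) \<times> real \<Rightarrow> real" where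
  "p_diffusion_dir p a \<phi> z =
     (\<Sum>i\<in>UNIV. \<Sum>j\<in>UNIV.
        (of_bool (i = j) + (p - 2) * (a $ i * a $ j)) * space_hessian \<phi> z $ i $ j)"

(* Infima and suprema over |a| = 1 are of continuous functions on a nonempty compact set, so
   the conditionally complete INF and SUP on the reals have their usual meaning. *)
definition viscosity_subsolution ::
    "real \<Rightarrow> (real \<Rightarrow> real) \<Rightarrow> real \<Rightarrow> ((real ^ 'n) \<times> real \<Rightarrow> real) \<Rightarrow> bool" where
  "viscosity_subsolution p f T u \<longleftrightarrow>
     continuous_on (UNIV \<times> {0<..<T}) u \<and> bounded (u ` (UNIV \<times> {0<..<T})) \<and>
     (\<forall>\<phi> z. C2_on (UNIV \<times> {0<..<T}) \<phi> \<longrightarrow>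
        local_max_at (UNIV \<times> {0<..<T}) (\<lambda>w. u w - \<phi> w) z \<longrightarrow>
        (space_gradient \<phi> z \<noteq> 0 \<longrightarrow>
           time_deriv \<phi> z + pow_two_minus p (norm (space_gradient \<phi> z)) * f (u z)
             \<le> p_diffusion p \<phi> z) \<and>
        (space_gradient \<phi> z = 0 \<longrightarrow>
           (INF a\<in>sphere 0 1. time_deriv \<phi> z
              + pow_two_minus p (norm (space_gradient \<phi> z)) * f (u z)
              - p_diffusion_dir p a \<phi> z) \<le> 0))"

definition viscosity_supersolution ::
    "real \<Rightarrow> (real \<Rightarrow> real) \<Rightarrow> real \<Rightarrow> ((real ^ 'n) \<times> real \<Rightarrow> real) \<Rightarrow> bool" where
  "viscosity_supersolution p f T u \<longleftrightarrow>
     continuous_on (UNIV \<times> {0<..<T}) u \<and> bounded (u ` (UNIV \<times> {0<..<T})) \<and>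
     (\<forall>\<phi> z. C2_on (UNIV \<times> {0<..<T}) \<phi> \<longrightarrow>
        local_min_at (UNIV \<times> {0<..<T}) (\<lambda>w. u w - \<phi> w) z \<longrightarrow>
        (space_gradient \<phi> z \<noteq> 0 \<longrightarrow>
           time_deriv \<phi> z + pow_two_minus p (norm (space_gradient \<phi> z)) * f (u z)
             \<ge> p_diffusion p \<phi> z) \<and>
        (space_gradient \<phi> z = 0 \<longrightarrow>
           (SUP a\<in>sphere 0 1. time_deriv \<phi> z
              + pow_two_minus p (norm (space_gradient \<phi> z)) * f (u z)
              - p_diffusion_dir p a \<phi> z) \<ge> 0))"

definition viscosity_solution ::
    "real \<Rightarrow> (real \<Rightarrow> real) \<Rightarrow> real \<Rightarrow> ((real ^ 'n) \<times> real \<Rightarrow> real) \<Rightarrow> bool" where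
  "viscosity_solution p f T u \<longleftrightarrow> viscosity_subsolution p f T u \<and> viscosity_supersolution p f T u"

end

theory Submission
  imports Defs
begin

text \<open>
  Put \<open>c = u (x0, t0)\<close>. Since \<open>F\<close> has a minimum at \<open>c\<close>, we have \<open>F (c) = f (c) = 0\<close>, \<open>|f (r)| \<le> K |r - c|\<close>
  and \<open>F (r) \<le> K |r - c|\<^sup>2\<close> on the range of \<open>u\<close>. The gradient bound is needed only at time 0: it gives
  \<open>|Dg| \<le> C |g - c|\<close> a.e., so by a Gronwall argument on lines \<open>g\<close> either equals \<open>c\<close> everywhere or omits
  the value \<open>c\<close>. In the first case comparison with the constant solution \<open>c\<close>, from both sides, gives
  \<open>u = c\<close>. In the second case, say \<open>g > c\<close>, comparison gives \<open>u \<ge> c\<close>, and the local barrier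
  \<open>c + \<delta> exp (- \<Lambda> t) (R\<^sup>2 - |x - x0|\<^sup>2)\<^sup>2\<close> gives \<open>u (x0, t) > c\<close> for all \<open>t\<close>, a contradiction. Both comparisons
  are with smooth strict sub- or supersolutions, which serve directly as test functions.
\<close>

section \<open>Almost everywhere differentiability of Lipschitz functions on the line\<close>

text \<open>The gradient hypothesis holds only off a null set of R^n, and \<open>gradient\<close>
  has arbitrary components where a partial derivative fails to exist. Fubini carries the hypothesis
  to almost every line parallel to a given axis, but on such a line it is again known only almost
  everywhere. The Gronwall argument therefore rests on a mean value inequality that tolerates an
  exceptional null set; this is the purpose of the covering estimates for functions of one variable.
  The linear bound on \<open>|Dg|\<close> comes from p \<le> 2: the p-th power of
  \<open>|Dg|\<close> is at most a multiple of the square of g - c, and the exponent 2/p is at least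
  1 while g - c is bounded. In the comparisons the equation is not monotone in u. The lower order
  term is still controlled by K |u - c| as soon as the barrier has gradient of norm at most 1,
  because then the factor with exponent 2 - p is at most 1; an exponential in time absorbs it.
  Smallness of the barrier's gradient is thus a constraint on the constants in both comparisons. It
  is not automatic on unbounded space, where a penalty growing with |x| is needed.\<close>

text \<open>Outer measure avoids having to prove that the exceptional sets are measurable.\<close>

lemma outer_measure_strict_mono_image_le:
  fixes H :: "real \<Rightarrow> real"
  assumes sm: "strict_mono H" and lip: "L-lipschitz_on UNIV H" and "0 < p"
    and slope: "\<And>x d. \<lbrakk>x \<in> E; 0 < d\<rbrakk> \<Longrightarrow>
      \<exists>a b. a \<le> x \<and> x \<le> b \<and> a < b \<and> b - a < d \<and> H b - H a \<le> p * (b - a)"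
  shows "outer_measure_of lebesgue (H ` E) \<le> ennreal p * outer_measure_of lebesgue E"
proof -
  have main: "outer_measure_of lebesgue (H ` E) \<le> ennreal p * emeasure lebesgue U"
    if U: "open U" "E \<subseteq> U" for U
  proof -
    \<comment> \<open>A pair stands for a closed interval inside \<open>U\<close> whose mean slope
      under \<open>H\<close> is at most \<open>p\<close>. Since the hypothesis supplies such
      intervals of arbitrarily small length around each point of \<open>E\<close>, they form a
      Vitali cover; \<open>ctr\<close> and \<open>rad\<close> rewrite them as closed balls.\<close>
    define K where "K = {i::real\<times>real. fst i < snd i \<and> {fst i..snd i} \<subseteq> U \<and> H (snd i) - H (fst i) \<le> p * (snd i - fst i)}"
    define ctr where "ctr i = (fst i + snd i) / 2" for i :: "real \<times> real"
    define rad where "rad i = (snd i - fst i) / 2" for i :: "real \<times> real"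
    have cb: "cball (ctr i) (rad i) = {fst i..snd i}" for i
      by (auto simp: cball_eq_atLeastAtMost ctr_def rad_def field_simps)
    have S: "\<exists>i. i \<in> K \<and> x \<in> cball (ctr i) (rad i) \<and> rad i < d" if "x \<in> E" "0 < d" for x d
    proof -
      obtain e where e: "e > 0" "ball x e \<subseteq> U"
        using U \<open>x \<in> E\<close> by (meson open_contains_ball subsetD)
      obtain a b where ab: "a \<le> x" "x \<le> b" "a < b" "b - a < min d e" "H b - H a \<le> p * (b - a)"
        using slope[OF \<open>x \<in> E\<close>, of "min d e"] \<open>0 < d\<close> e by auto
      have "{a..b} \<subseteq> ball x e" using ab by (auto simp: dist_real_def)
      then have "(a, b) \<in> K" using ab e by (auto simp: K_def)
      moreover have "x \<in> cball (ctr (a, b)) (rad (a, b))" using ab unfolding cb by simp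
      ultimately show ?thesis using ab by (intro exI[of _ "(a, b)"]) (auto simp: rad_def)
    qed
    obtain C where C: "countable C" "C \<subseteq> K"
      "pairwise (\<lambda>i j. disjnt (cball (ctr i) (rad i)) (cball (ctr j) (rad j))) C"
      "negligible (E - (\<Union>i \<in> C. cball (ctr i) (rad i)))"
      by (rule Vitali_covering_theorem_cballs[of K rad E ctr, OF _ S]) (auto simp: K_def rad_def)
    have disj: "disjoint_family_on (\<lambda>i. {fst i..snd i}) C"
      using C(3) by (auto simp: cb disjoint_family_on_def pairwise_def disjnt_def)
    have disjH: "disjoint_family_on (\<lambda>i. {H (fst i)..H (snd i)}) C"
    proof (unfold disjoint_family_on_def, intro ballI impI)
      fix i j assume ij: "i \<in> C" "j \<in> C" "i \<noteq> j"
      have lt: "fst i < snd i" "fst j < snd j" using ij C(2) by (auto simp: K_def)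
      have "{fst i..snd i} \<inter> {fst j..snd j} = {}" using disj ij by (auto simp: disjoint_family_on_def)
      then have "snd i < fst j \<or> snd j < fst i"
        using lt by (metis Int_iff atLeastAtMost_iff empty_iff linorder_not_less nle_le order.strict_implies_order)
      then have "H (snd i) < H (fst j) \<or> H (snd j) < H (fst i)"
        using sm by (auto simp: strict_mono_def)
      then show "{H (fst i)..H (snd i)} \<inter> {H (fst j)..H (snd j)} = {}" by auto
    qed
    \<comment> \<open>The part of \<open>E\<close> missed by the disjoint intervals is null, and a
      Lipschitz map keeps it null, so only the images of the chosen intervals contribute to the
      measure.\<close>
    let ?N = "E - (\<Union>i \<in> C. {fst i..snd i})"
    have "negligible (H ` ?N)"
    proof (rule negligible_locally_Lipschitz_image)
      show "negligible ?N" using C(4) by (simp add: cb)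
      show "\<exists>T B. open T \<and> x \<in> T \<and> (\<forall>y\<in>?N \<inter> T. norm (H y - H x) \<le> B * norm (y - x))" for x
        using lipschitz_onD[OF lip] by (intro exI[of _ UNIV] exI[of _ L]) (auto simp: dist_norm)
    qed simp
    then have null: "H ` ?N \<in> null_sets lebesgue" by (simp add: negligible_iff_null_sets)
    let ?W = "\<Union>i\<in>C. {H (fst i)..H (snd i)}"
    have W: "?W \<in> sets lebesgue" using C(1) by (intro sets.countable_UN') auto
    have sub: "H ` E \<subseteq> ?W \<union> H ` ?N"
    proof
      fix y assume "y \<in> H ` E"
      then obtain x where x: "x \<in> E" "y = H x" by auto
      show "y \<in> ?W \<union> H ` ?N"
      proof (cases "x \<in> ?N")
        case False
        then obtain i where "i \<in> C" "fst i \<le> x" "x \<le> snd i" using x by auto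
        then have "y \<in> {H (fst i)..H (snd i)}"
          using x strict_mono_mono[OF sm] by (auto simp: mono_def)
        then show ?thesis using \<open>i \<in> C\<close> by blast
      qed (use x in auto)
    qed
    have "outer_measure_of lebesgue (H ` E) \<le> outer_measure_of lebesgue (?W \<union> H ` ?N)"
      by (rule outer_measure_of_mono[OF sub])
    also have "\<dots> = emeasure lebesgue (?W \<union> H ` ?N)"
      using W null by (intro outer_measure_of_eq) auto
    also have "\<dots> = emeasure lebesgue ?W"
      using W null by (rule emeasure_Un_null_set)
    also have "\<dots> = (\<integral>\<^sup>+i. emeasure lebesgue {H (fst i)..H (snd i)} \<partial>count_space C)"
      using C(1) disjH by (intro emeasure_UN_countable) auto
    also have "\<dots> \<le> (\<integral>\<^sup>+i. ennreal p * emeasure lebesgue {fst i..snd i} \<partial>count_space C)"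
    proof (intro nn_integral_mono)
      fix i assume "i \<in> space (count_space C)"
      then have i: "fst i < snd i" "H (snd i) - H (fst i) \<le> p * (snd i - fst i)"
        using C(2) by (auto simp: K_def)
      have "H (fst i) \<le> H (snd i)" using i sm by (simp add: strict_mono_less_eq)
      then show "emeasure lebesgue {H (fst i)..H (snd i)} \<le> ennreal p * emeasure lebesgue {fst i..snd i}"
        using i \<open>0 < p\<close> by (simp add: ennreal_mult[symmetric])
    qed
    also have "\<dots> = ennreal p * (\<integral>\<^sup>+i. emeasure lebesgue {fst i..snd i} \<partial>count_space C)"
      by (intro nn_integral_cmult) auto
    also have "\<dots> = ennreal p * emeasure lebesgue (\<Union>i\<in>C. {fst i..snd i})"
      using C(1) disj by (subst emeasure_UN_countable) auto
    also have "\<dots> \<le> ennreal p * emeasure lebesgue U"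
      using C(2) U by (intro mult_left_mono emeasure_mono) (auto simp: K_def)
    finally show ?thesis .
  qed
  obtain B where B: "B \<in> sets lebesgue" "E \<subseteq> B" "outer_measure_of lebesgue E = emeasure lebesgue B"
    using outer_measure_of_attain[of E lebesgue] by auto
  show ?thesis
  proof (rule ennreal_le_epsilon)
    fix e :: real assume "0 < e"
    \<comment> \<open>The excess e / p of the open set over the measurable hull \<open>B\<close>
      becomes exactly \<open>e\<close> after multiplication by the slope \<open>p\<close>.\<close>
    obtain U where U: "open U" "B \<subseteq> U" "U - B \<in> lmeasurable" "emeasure lebesgue (U - B) < ennreal (e / p)"
      using sets_lebesgue_outer_open[OF B(1), of "e / p"] \<open>0 < e\<close> \<open>0 < p\<close> by auto
    have "emeasure lebesgue U = emeasure lebesgue (B \<union> (U - B))" using U(2) by (simp add: Un_absorb1)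
    also have "\<dots> \<le> emeasure lebesgue B + emeasure lebesgue (U - B)"
      using B U by (intro emeasure_subadditive) auto
    also have "\<dots> \<le> emeasure lebesgue B + ennreal (e / p)" using U(4) by (intro add_left_mono) auto
    finally have "ennreal p * emeasure lebesgue U \<le> ennreal p * (emeasure lebesgue B + ennreal (e / p))"
      by (intro mult_left_mono) auto
    also have "\<dots> = ennreal p * emeasure lebesgue B + ennreal e"
      using \<open>0 < e\<close> \<open>0 < p\<close> by (simp add: distrib_left ennreal_mult[symmetric])
    finally show "outer_measure_of lebesgue (H ` E) \<le> ennreal p * outer_measure_of lebesgue E + ennreal e"
      using main[of U] U B by (auto intro: order_trans)
  qed
qed

text \<open>The image estimate for \<open>H\<close> and for its inverse give \<open>|E| \<le> (p / q) * |E|\<close>.\<close>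

lemma negligible_small_and_large_slopes:
  fixes H :: "real \<Rightarrow> real"
  assumes lo: "\<And>x y. x \<le> y \<Longrightarrow> c1 * (y - x) \<le> H y - H x"
    and hi: "\<And>x y. x \<le> y \<Longrightarrow> H y - H x \<le> c2 * (y - x)"
    and "0 < c1" and "0 < p" and "p < q" and "bounded E"
    and small: "\<And>x d. \<lbrakk>x \<in> E; 0 < d\<rbrakk> \<Longrightarrow>
      \<exists>a b. a \<le> x \<and> x \<le> b \<and> a < b \<and> b - a < d \<and> H b - H a \<le> p * (b - a)"
    and large: "\<And>x d. \<lbrakk>x \<in> E; 0 < d\<rbrakk> \<Longrightarrow>
      \<exists>a b. a \<le> x \<and> x \<le> b \<and> a < b \<and> b - a < d \<and> q * (b - a) \<le> H b - H a"
  shows "negligible E"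
proof -
  have pos: "0 < H y - H x" if "x < y" for x y
    using lo[of x y] that \<open>0 < c1\<close> by (smt (verit) mult_pos_pos)
  have c2: "0 < c2" using hi[of 0 1] pos[of 0 1] by auto
  have sm: "strict_mono H" using pos by (simp add: strict_mono_def)
  have lip: "c2-lipschitz_on UNIV H"
  proof (rule lipschitz_onI)
    show "dist (H x) (H y) \<le> c2 * dist x y" for x y
      using hi[of x y] hi[of y x] strict_mono_less_eq[OF sm, of x y] strict_mono_less_eq[OF sm, of y x]
      by (cases "x \<le> y") (auto simp: dist_real_def)
  qed (use c2 in auto)
  have inj: "inj H" using sm by (rule strict_mono_imp_inj_on)
  \<comment> \<open>The lower slope bound \<open>c1\<close> forces linear growth in both directions,
    so the intermediate value theorem reaches every value and the inverse is defined on the whole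
    line.\<close>
  have surj: "surj H"
  proof (rule surjI)
    fix y
    have "\<exists>x. H x = y"
    proof -
      define r where "r = \<bar>y - H 0\<bar> / c1"
      have r: "0 \<le> r" "c1 * r = \<bar>y - H 0\<bar>" using \<open>0 < c1\<close> by (auto simp: r_def)
      have "H (- r) \<le> y" "y \<le> H r" using lo[of 0 r] lo[of "-r" 0] r by auto
      moreover have "continuous_on {-r..r} H"
        using lipschitz_on_continuous_on[OF lip] continuous_on_subset by blast
      ultimately show ?thesis using IVT'[of H "-r" y r] r by auto
    qed
    then show "H (inv H y) = y" by (metis f_inv_into_f rangeI)
  qed
  let ?G = "inv H"
  have GH: "?G (H x) = x" and HG: "H (?G y) = y" for x y
    using inj surj by (auto simp: surj_f_inv_f)
  have smG: "strict_mono ?G"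
    by (rule strict_monoI) (metis HG sm strict_mono_less)
  have lipG: "(1 / c1)-lipschitz_on UNIV ?G"
  proof (rule lipschitz_onI)
    fix x y
    show "dist (?G x) (?G y) \<le> 1 / c1 * dist x y"
      using lo[of "?G x" "?G y"] lo[of "?G y" "?G x"] \<open>0 < c1\<close>
      by (cases "?G x \<le> ?G y") (auto simp: dist_real_def HG field_simps)
  qed (use \<open>0 < c1\<close> in auto)
  let ?m = "outer_measure_of (lebesgue :: real measure)"
  have 1: "?m (H ` E) \<le> ennreal p * ?m E"
    by (rule outer_measure_strict_mono_image_le[OF sm lip \<open>0 < p\<close> small])
  have 2: "?m (?G ` (H ` E)) \<le> ennreal (1 / q) * ?m (H ` E)"
  proof (rule outer_measure_strict_mono_image_le[OF smG lipG])
    show "0 < 1 / q" using \<open>0 < p\<close> \<open>p < q\<close> by simp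
    fix y d :: real assume "y \<in> H ` E" "0 < d"
    then obtain x where x: "x \<in> E" "y = H x" by auto
    \<comment> \<open>An interval shorter than d / c2 has an image shorter than \<open>d\<close>; a
      mean slope of at least \<open>q\<close> for \<open>H\<close> is a mean slope of at most 1 / q
      for the inverse.\<close>
    obtain a b where ab: "a \<le> x" "x \<le> b" "a < b" "b - a < d / c2" "q * (b - a) \<le> H b - H a"
      using large[OF x(1), of "d / c2"] \<open>0 < d\<close> c2 by auto
    have "H b - H a \<le> c2 * (b - a)" using hi[of a b] ab by auto
    also have "\<dots> < d" using ab(4) c2 by (simp add: field_simps)
    finally have "H b - H a < d" .
    moreover have "?G (H b) - ?G (H a) \<le> 1 / q * (H b - H a)"
      using ab \<open>0 < p\<close> \<open>p < q\<close> by (simp add: GH field_simps)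
    ultimately show "\<exists>a b. a \<le> y \<and> y \<le> b \<and> a < b \<and> b - a < d \<and> ?G b - ?G a \<le> 1 / q * (b - a)"
      using ab x sm by (intro exI[of _ "H a"] exI[of _ "H b"]) (auto simp: strict_mono_less strict_mono_less_eq)
  qed
  have "?G ` (H ` E) = E" by (auto simp: image_image GH)
  with 2 have "?m E \<le> ennreal (1 / q) * ?m (H ` E)" by simp
  also have "\<dots> \<le> ennreal (1 / q) * (ennreal p * ?m E)" by (rule mult_left_mono[OF 1]) simp
  also have "\<dots> = ennreal (p / q) * ?m E"
    using \<open>0 < p\<close> \<open>p < q\<close> by (simp add: ennreal_mult[symmetric] mult.assoc[symmetric])
  finally have le: "?m E \<le> ennreal (p / q) * ?m E" .
  \<comment> \<open>Boundedness makes the outer measure of \<open>E\<close> finite, so that the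
    inequality with factor p / q < 1 forces it to vanish.\<close>
  obtain N where "\<And>x. x \<in> E \<Longrightarrow> \<bar>x\<bar> \<le> N" using \<open>bounded E\<close> by (auto simp: bounded_iff)
  then have N: "E \<subseteq> {-N..N}" by (force simp: abs_le_iff)
  have "?m E \<le> ?m {-N..N}" by (rule outer_measure_of_mono[OF N])
  also have "\<dots> < top" by (simp add: emeasure_lborel_Icc_eq)
  finally have fin: "?m E < top" .
  then obtain r where r: "?m E = ennreal r" "0 \<le> r" by (cases "?m E") auto
  have "r \<le> p / q * r"
    using le r \<open>0 < p\<close> \<open>p < q\<close> by (simp add: ennreal_mult[symmetric])
  then have "r * (q - p) \<le> 0" using \<open>0 < p\<close> \<open>p < q\<close> by (simp add: field_simps)
  with r \<open>p < q\<close> have "r = 0" by (smt (verit) mult_pos_pos)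
  then have "?m E = 0" using r by simp
  then obtain B where "B \<in> sets lebesgue" "E \<subseteq> B" "emeasure lebesgue B = 0"
    using outer_measure_of_attain[of E lebesgue] by auto
  then show ?thesis using negligible_iff_null_sets negligible_subset by blast
qed

text \<open>Adding (L + 1) x makes all slopes lie between 1 and 2 L + 1 without affecting
  differentiability. At a point of non-differentiability the lower and upper limits of the
  difference quotient differ, so two rationals fit strictly between them. For each pair of rationals
  and each bounded piece the set of such points is null, and there are countably many
  choices.\<close>

theorem lipschitz_negligible_not_differentiable:
  fixes k :: "real \<Rightarrow> real"
  assumes lip: "L-lipschitz_on UNIV k"
  shows "negligible {x. \<not> k differentiable (at x)}"
proof -
  define H where "H x = (L + 1) * x + k x" for x
  have kb: "\<bar>k y - k x\<bar> \<le> L * \<bar>y - x\<bar>" for x y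
    using lipschitz_onD[OF lip] by (simp add: dist_real_def)
  have lo: "1 * (y - x) \<le> H y - H x" and hi: "H y - H x \<le> (2 * L + 1) * (y - x)" if "x \<le> y" for x y
    using kb[of y x] that by (auto simp: H_def algebra_simps)
  define S where "S p q x \<longleftrightarrow> (\<forall>d>0. \<exists>a b. a \<le> x \<and> x \<le> b \<and> a < b \<and> b - a < d \<and> H b - H a \<le> p * (b - a)) \<and>
     (\<forall>d>0. \<exists>a b. a \<le> x \<and> x \<le> b \<and> a < b \<and> b - a < d \<and> q * (b - a) \<le> H b - H a)" for p q x
  define A where "A = (\<lambda>(p::rat, q::rat, N::nat). {x \<in> cball 0 (real N). S (of_rat p) (of_rat q) x})"
  have "negligible (\<Union> (A ` {(p, q, N). 0 < p \<and> p < q}))"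
  proof (rule negligible_countable_Union)
    fix X assume "X \<in> A ` {(p, q, N). 0 < p \<and> p < q}"
    then obtain p q N where X: "X = A (p, q, N)" "0 < p" "p < q" by auto
    show "negligible X"
    proof (rule negligible_small_and_large_slopes[where H = H and p = "of_rat p" and q = "of_rat q", OF lo hi])
      show "bounded X" by (rule bounded_subset[OF bounded_cball[of 0 "real N"]]) (auto simp: X A_def)
    qed (use X in \<open>auto simp: A_def S_def of_rat_less\<close>)
  qed auto
  moreover have "{x. \<not> k differentiable (at x)} \<subseteq> \<Union> (A ` {(p, q, N). 0 < p \<and> p < q})"
  proof (rule subsetI, rule ccontr)
    fix x assume "x \<in> {x. \<not> k differentiable (at x)}"
    then have nd: "\<not> k differentiable (at x)" by simp
    assume notin: "x \<notin> \<Union> (A ` {(p, q, N). 0 < p \<and> p < q})"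
    define \<phi> where "\<phi> y = (H y - H x) / (y - x)" for y
    have bnd: "1 \<le> \<phi> y" "\<phi> y \<le> 2 * L + 1" if "y \<noteq> x" for y
      using lo[of x y] hi[of x y] lo[of y x] hi[of y x] that
      by (cases "x < y"; simp add: \<phi>_def field_simps)+
    let ?I = "Liminf (at x) (\<lambda>y. ereal (\<phi> y))"
    let ?S = "Limsup (at x) (\<lambda>y. ereal (\<phi> y))"
    have I1: "1 \<le> ?I"
      by (rule Liminf_bounded) (auto simp: eventually_at_filter bnd)
    have S2: "?S \<le> ereal (2 * L + 1)"
      by (rule Limsup_bounded) (auto simp: eventually_at_filter intro!: always_eventually bnd)
    have IS: "?I \<le> ?S" by (rule Liminf_le_Limsup) simp
    show False
    proof (cases "?I = ?S")
      case True
      obtain D where D: "?I = ereal D" using I1 S2 IS by (cases ?I) auto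
      have "((\<lambda>y. ereal (\<phi> y)) \<longlongrightarrow> ereal D) (at x)"
        using True D by (subst tendsto_iff_Liminf_eq_Limsup) auto
      then have "(\<phi> \<longlongrightarrow> D) (at x)" by simp
      then have "(H has_real_derivative D) (at x)" unfolding has_field_derivative_iff \<phi>_def .
      then have "((\<lambda>y. H y - (L + 1) * y) has_real_derivative D - (L + 1)) (at x)"
        by (auto intro!: derivative_eq_intros)
      then have "(k has_real_derivative D - (L + 1)) (at x)" by (simp add: H_def)
      then show False using nd real_differentiable_def by blast
    next
      case False
      with IS have "?I < ?S" by simp
      then obtain p :: rat where p: "?I < real_of_rat p" "real_of_rat p < ?S" using ereal_dense3 by blast
      then obtain q :: rat where q: "real_of_rat p < ereal (real_of_rat q)" "real_of_rat q < ?S"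
        using ereal_dense3 by blast
      have "0 < real_of_rat p" using I1 p(1) by (cases ?I) (auto simp: one_ereal_def simp del: zero_less_of_rat_iff)
      then have pq: "0 < p" "p < q" using q by (auto simp: of_rat_less)
      have fp: "frequently (\<lambda>y. \<phi> y < of_rat p) (at x)"
      proof (rule ccontr)
        assume "\<not> ?thesis"
        then have "\<forall>\<^sub>F y in at x. ereal (of_rat p) \<le> ereal (\<phi> y)" by (simp add: frequently_def not_less)
        then have "ereal (of_rat p) \<le> ?I" by (rule Liminf_bounded)
        with p show False by simp
      qed
      have fq: "frequently (\<lambda>y. of_rat q < \<phi> y) (at x)"
      proof (rule ccontr)
        assume "\<not> ?thesis"
        then have "\<forall>\<^sub>F y in at x. ereal (\<phi> y) \<le> ereal (of_rat q)" by (simp add: frequently_def not_less)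
        then have "?S \<le> ereal (of_rat q)" by (rule Limsup_bounded)
        with q show False by simp
      qed
      have near: "\<exists>y. y \<noteq> x \<and> \<bar>y - x\<bar> < d \<and> P y" if "frequently P (at x)" "0 < d" for P d
        using that unfolding frequently_at by (auto simp: dist_real_def)
      have "S (of_rat p) (of_rat q) x"
        unfolding S_def
      proof (intro conjI allI impI)
        fix d :: real assume "0 < d"
        obtain y where y: "y \<noteq> x" "\<bar>y - x\<bar> < d" "\<phi> y < of_rat p" using near[OF fp \<open>0 < d\<close>] by blast
        show "\<exists>a b. a \<le> x \<and> x \<le> b \<and> a < b \<and> b - a < d \<and> H b - H a \<le> of_rat p * (b - a)"
        proof (cases "x < y")
          case True
          then show ?thesis using y by (intro exI[of _ x] exI[of _ y]) (auto simp: \<phi>_def field_simps)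
        next
          case False
          then show ?thesis using y by (intro exI[of _ y] exI[of _ x]) (auto simp: \<phi>_def field_simps)
        qed
      next
        fix d :: real assume "0 < d"
        obtain y where y: "y \<noteq> x" "\<bar>y - x\<bar> < d" "of_rat q < \<phi> y" using near[OF fq \<open>0 < d\<close>] by blast
        show "\<exists>a b. a \<le> x \<and> x \<le> b \<and> a < b \<and> b - a < d \<and> of_rat q * (b - a) \<le> H b - H a"
        proof (cases "x < y")
          case True
          then show ?thesis using y by (intro exI[of _ x] exI[of _ y]) (auto simp: \<phi>_def field_simps)
        next
          case False
          then show ?thesis using y by (intro exI[of _ y] exI[of _ x]) (auto simp: \<phi>_def field_simps)
        qed
      qed
      moreover obtain N :: nat where "\<bar>x\<bar> \<le> real N" using real_arch_simple by blast
      ultimately have "x \<in> A (p, q, N)" by (simp add: A_def)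
      then show False using notin pq by blast
    qed
  qed
  ultimately show ?thesis by (rule negligible_subset)
qed

text \<open>A mean value inequality in which the derivative bound may fail on a null set. After a
  linear term is added, the points with derivative at most \<Theta> have small intervals of mean
  slope at most c + \<Theta> + e, and the covering estimate bounds the length of their image. The
  remaining points are null and have a null image, yet both images together cover the interval from
  H a to H b.\<close>

theorem lipschitz_increment_le:
  fixes k :: "real \<Rightarrow> real"
  assumes lip: "L-lipschitz_on UNIV k" and "negligible N" and "a \<le> b"
    and der: "\<And>s D. \<lbrakk>s \<in> {a..b} - N; (k has_real_derivative D) (at s)\<rbrakk> \<Longrightarrow> D \<le> \<Theta>"
  shows "k b - k a \<le> \<Theta> * (b - a)"
proof (rule field_le_epsilon)
  fix e0 :: real assume "0 < e0"
  define e where "e = e0 / (b - a + 1)"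
  have e: "0 < e" "e * (b - a) \<le> e0" using \<open>0 < e0\<close> \<open>a \<le> b\<close> by (auto simp: e_def field_simps)
  have "0 \<le> L" using lip lipschitz_on_nonneg by blast
  \<comment> \<open>L + 1 makes \<open>H\<close> strictly increasing, and the absolute value of
    \<Theta> makes the slope c + \<Theta> + e positive even for negative \<Theta>.\<close>
  define c where "c = L + 1 + \<bar>\<Theta>\<bar>"
  have "0 \<le> c" using \<open>0 \<le> L\<close> by (simp add: c_def)
  define H where "H x = c * x + k x" for x
  have kb: "\<bar>k y - k x\<bar> \<le> L * \<bar>y - x\<bar>" for x y
    using lipschitz_onD[OF lip] by (simp add: dist_real_def)
  have sm: "strict_mono H"
  proof (rule strict_monoI)
    fix x y :: real assume "x < y"
    then have "L * (y - x) < c * (y - x)" by (intro mult_strict_right_mono) (auto simp: c_def)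
    then show "H x < H y" using kb[of y x] \<open>x < y\<close> by (auto simp: H_def algebra_simps)
  qed
  have lipH: "(c + L)-lipschitz_on UNIV H"
  proof (rule lipschitz_onI)
    fix x y
    have "\<bar>H x - H y\<bar> \<le> \<bar>c * (x - y)\<bar> + \<bar>k x - k y\<bar>" by (simp add: H_def algebra_simps)
    also have "\<dots> \<le> (c + L) * \<bar>x - y\<bar>"
      using kb[of x y] \<open>0 \<le> c\<close> by (simp add: abs_mult distrib_right)
    finally show "dist (H x) (H y) \<le> (c + L) * dist x y" by (simp add: dist_real_def)
  qed (use \<open>0 \<le> L\<close> in \<open>auto simp: c_def\<close>)
  define Z where "Z = {a, b} \<union> N \<union> {x. \<not> k differentiable (at x)}"
  have "negligible Z" unfolding Z_def
    using \<open>negligible N\<close> lipschitz_negligible_not_differentiable[OF lip]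
    by (intro negligible_Un) (auto simp: negligible_finite)
  have "negligible (H ` Z)"
  proof (rule negligible_locally_Lipschitz_image)
    show "\<exists>T B. open T \<and> x \<in> T \<and> (\<forall>y\<in>Z \<inter> T. norm (H y - H x) \<le> B * norm (y - x))" for x
      using lipschitz_onD[OF lipH] by (intro exI[of _ UNIV] exI[of _ "c + L"]) (auto simp: dist_norm)
  qed (use \<open>negligible Z\<close> in auto)
  let ?p = "c + \<Theta> + e"
  have p: "0 < ?p" using e \<open>0 \<le> L\<close> by (auto simp: c_def)
  let ?E = "{a..b} - Z"
  have "outer_measure_of lebesgue (H ` ?E) \<le> ennreal ?p * outer_measure_of lebesgue ?E"
  proof (rule outer_measure_strict_mono_image_le[OF sm lipH p])
    fix x d :: real assume x: "x \<in> ?E" and "0 < d"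
    then obtain D where D: "(k has_real_derivative D) (at x)"
      by (auto simp: Z_def real_differentiable_def)
    have "D \<le> \<Theta>" using der[OF _ D] x by (auto simp: Z_def)
    have "((\<lambda>y. (k y - k x) / (y - x)) \<longlongrightarrow> D) (at x)" using D by (simp add: has_field_derivative_iff)
    then have "\<forall>\<^sub>F y in at x. (k y - k x) / (y - x) < \<Theta> + e"
      using \<open>D \<le> \<Theta>\<close> e by (intro order_tendstoD(2)) auto
    then obtain d' where d': "d' > 0" "\<And>y. y \<noteq> x \<Longrightarrow> \<bar>y - x\<bar> < d' \<Longrightarrow> (k y - k x) / (y - x) < \<Theta> + e"
      unfolding eventually_at by (auto simp: dist_real_def)
    define y where "y = x + min d d' / 2"
    have y: "x < y" "y - x < d" "y - x < d'" using \<open>0 < d\<close> d' by (auto simp: y_def min_def)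
    have "(k y - k x) / (y - x) < \<Theta> + e" using y by (intro d') auto
    then have "k y - k x \<le> (\<Theta> + e) * (y - x)" using y by (simp add: field_simps)
    then show "\<exists>a b. a \<le> x \<and> x \<le> b \<and> a < b \<and> b - a < d \<and> H b - H a \<le> ?p * (b - a)"
      using y by (intro exI[of _ x] exI[of _ y]) (auto simp: H_def algebra_simps)
  qed
  also have "\<dots> \<le> ennreal ?p * outer_measure_of lebesgue {a..b}"
    by (intro mult_left_mono outer_measure_of_mono) auto
  also have "\<dots> = ennreal (?p * (b - a))"
    using \<open>a \<le> b\<close> p by (simp add: ennreal_mult)
  finally have 1: "outer_measure_of lebesgue (H ` ?E) \<le> ennreal (?p * (b - a))" .
  have sub: "{H a..H b} \<subseteq> H ` ?E \<union> H ` Z"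
  proof
    fix y assume "y \<in> {H a..H b}"
    moreover have "continuous_on {a..b} H"
      using lipschitz_on_continuous_on[OF lipH] continuous_on_subset by blast
    ultimately obtain x where "x \<in> {a..b}" "H x = y" using IVT'[of H a y b] \<open>a \<le> b\<close> by auto
    then show "y \<in> H ` ?E \<union> H ` Z" by blast
  qed
  obtain B where B: "B \<in> sets lebesgue" "H ` ?E \<subseteq> B" "outer_measure_of lebesgue (H ` ?E) = emeasure lebesgue B"
    using outer_measure_of_attain[of "H ` ?E" lebesgue] by auto
  have null: "H ` Z \<in> null_sets lebesgue"
    using \<open>negligible (H ` Z)\<close> by (simp add: negligible_iff_null_sets)
  have "emeasure lebesgue {H a..H b} \<le> emeasure lebesgue (B \<union> H ` Z)"
    using sub B null by (intro emeasure_mono) auto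
  also have "\<dots> = emeasure lebesgue B" using B(1) null by (rule emeasure_Un_null_set)
  also have "\<dots> \<le> ennreal (?p * (b - a))" using 1 B(3) by simp
  finally have "ennreal (H b - H a) \<le> ennreal (?p * (b - a))"
    using \<open>a \<le> b\<close> sm by (simp add: strict_mono_less_eq)
  then have "H b - H a \<le> ?p * (b - a)" using p \<open>a \<le> b\<close> by (simp add: ennreal_le_iff)
  then show "k b - k a \<le> \<Theta> * (b - a) + e0" using e by (simp add: H_def algebra_simps)
qed

section \<open>Gronwall argument for the initial datum\<close>

text \<open>For fixed \<open>s\<close> the exceptional points are a translate of a null set, hence
  null in \<open>x\<close>; Fubini then exchanges the two quantifiers. Passing to a Borel null
  superset \<open>N\<close> supplies the measurability that Fubini requires.\<close>

lemma AE_lebesgue_imp_AE_lines: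
  fixes P :: "'a::euclidean_space \<Rightarrow> bool" and e :: 'a
  assumes "AE x in lebesgue. P x"
  shows "AE x in lborel. AE s in lborel. P (x + s *\<^sub>R e)"
proof -
  have "AE x in lborel. P x" using assms by (simp add: AE_completion_iff)
  then obtain N where N: "{x. \<not> P x} \<subseteq> N" "N \<in> null_sets (lborel :: 'a measure)"
    by (auto elim!: AE_E simp: null_sets_def)
  have "AE x in lborel. x + s *\<^sub>R e \<notin> N" for s
  proof -
    have "AE x in distr lborel borel ((+) (s *\<^sub>R e)). x \<notin> N"
      unfolding lborel_distr_plus by (rule AE_not_in[OF N(2)])
    then show ?thesis using N(2) by (subst (asm) AE_distr_iff) (auto simp: add.commute)
  qed
  then have *: "AE s in (lborel :: real measure). AE x in lborel. x + s *\<^sub>R e \<notin> N" by simp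
  have [measurable]: "N \<in> sets borel" using N(2) by auto
  have "AE x in lborel. AE s in (lborel :: real measure). x + s *\<^sub>R e \<notin> N"
    using * by (subst lborel_pair.AE_commute) measurable
  then show ?thesis by eventually_elim (use N(1) in \<open>auto elim!: eventually_mono\<close>)
qed

text \<open>Gronwall by absorption: if \<open>m\<close> is the maximum of the deviation over the
  interval, the derivative is at most C m, so the deviation changes by at most C \<tau> m \<le> m /
  2 between 0 and the maximum point. Hence m / 2 is at most the deviation at 0.\<close>

lemma deviation_doubles_at_most:
  fixes h :: "real \<Rightarrow> real"
  assumes lip: "L-lipschitz_on UNIV h" and "negligible N" and "0 \<le> C" and "C * \<tau> \<le> 1 / 2"
    and der: "\<And>s D. \<lbrakk>s \<notin> N; (h has_real_derivative D) (at s)\<rbrakk> \<Longrightarrow> \<bar>D\<bar> \<le> C * \<bar>h s - c\<bar>"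
    and s: "\<bar>s\<bar> \<le> \<tau>"
  shows "\<bar>h s - c\<bar> \<le> 2 * \<bar>h 0 - c\<bar>"
proof -
  have lip': "L-lipschitz_on UNIV (\<lambda>s. - h s)" using lip by (simp add: lipschitz_on_def dist_real_def)
  have "continuous_on {-\<tau>..\<tau>} h" using lipschitz_on_continuous_on[OF lip] continuous_on_subset by blast
  then have "\<exists>r\<in>{-\<tau>..\<tau>}. \<forall>s\<in>{-\<tau>..\<tau>}. \<bar>h s - c\<bar> \<le> \<bar>h r - c\<bar>"
    using s by (intro continuous_attains_sup) (auto intro!: continuous_intros)
  then obtain r where "r \<in> {-\<tau>..\<tau>}" "\<forall>s\<in>{-\<tau>..\<tau>}. \<bar>h s - c\<bar> \<le> \<bar>h r - c\<bar>" by blast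
  then have r: "\<bar>r\<bar> \<le> \<tau>" "\<And>s. \<bar>s\<bar> \<le> \<tau> \<Longrightarrow> \<bar>h s - c\<bar> \<le> \<bar>h r - c\<bar>"
    by (auto simp: abs_le_iff[of _ \<tau>])
  define m where "m = \<bar>h r - c\<bar>"
  have D: "\<bar>D\<bar> \<le> C * m" if "s \<notin> N" "\<bar>s\<bar> \<le> \<tau>" "(h has_real_derivative D) (at s)" for s D
    using der[OF that(1,3)] r(2)[OF that(2)] \<open>0 \<le> C\<close> unfolding m_def by (meson mult_left_mono order_trans)
  have inc: "\<bar>h b - h a\<bar> \<le> C * m * (b - a)" if "a \<le> b" "-\<tau> \<le> a" "b \<le> \<tau>" for a b
  proof -
    have "h b - h a \<le> C * m * (b - a)"
      by (rule lipschitz_increment_le[OF lip \<open>negligible N\<close> \<open>a \<le> b\<close>]) (use D that in force)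
    moreover have "- h b - - h a \<le> C * m * (b - a)"
    proof (rule lipschitz_increment_le[OF lip' \<open>negligible N\<close> \<open>a \<le> b\<close>])
      fix s D assume "s \<in> {a..b} - N" "((\<lambda>s. - h s) has_real_derivative D) (at s)"
      then have "(h has_real_derivative - D) (at s)" using DERIV_minus by fastforce
      moreover have "\<bar>s\<bar> \<le> \<tau>" using \<open>s \<in> {a..b} - N\<close> that by auto
      ultimately show "D \<le> C * m" using D[of s "-D"] \<open>s \<in> {a..b} - N\<close> by auto
    qed
    ultimately show ?thesis by auto
  qed
  have "\<bar>h r - h 0\<bar> \<le> C * m * \<bar>r\<bar>"
    using inc[of 0 r] inc[of r 0] r(1) by (cases "0 \<le> r") (auto simp: abs_minus_commute)
  also have "\<dots> \<le> C * m * \<tau>" using r(1) \<open>0 \<le> C\<close> by (intro mult_left_mono) (auto simp: m_def)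
  also have "\<dots> \<le> m / 2" using mult_right_mono[OF \<open>C * \<tau> \<le> 1 / 2\<close>, of m] by (simp add: m_def ac_simps)
  finally have "\<bar>h r - h 0\<bar> \<le> m / 2" .
  moreover have "m \<le> \<bar>h r - h 0\<bar> + \<bar>h 0 - c\<bar>" unfolding m_def by arith
  ultimately have "m \<le> 2 * \<bar>h 0 - c\<bar>" by (simp add: field_simps)
  then show ?thesis using r(2)[OF s] m_def by simp
qed

text \<open>On almost every axis-parallel line the deviation at most doubles over a step of length
  \<tau>. For a fixed step the set of base points violating this is open, by continuity of
  \<open>g\<close>, and null, hence empty. A zero deviation therefore survives every short step, and
  axis-parallel steps join \<open>x1\<close> to any point.\<close>

lemma constant_if_gradient_le_deviation:
  fixes g :: "real ^ 'n \<Rightarrow> real"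
  assumes lip: "L-lipschitz_on UNIV g" and "0 \<le> C"
    and ae: "AE x in lebesgue. norm (gradient g x) \<le> C * \<bar>g x - c\<bar>" and x1: "g x1 = c"
  shows "g x = c"
proof -
  \<comment> \<open>C + 1 instead of \<open>C\<close> keeps the step finite when \<open>C\<close> is
    0.\<close>
  define \<tau> where "\<tau> = 1 / (2 * (C + 1))"
  have \<tau>: "0 < \<tau>" "C * \<tau> \<le> 1 / 2" using \<open>0 \<le> C\<close> by (auto simp: \<tau>_def field_simps)
  have double: "\<bar>g (x + s *\<^sub>R axis i 1) - c\<bar> \<le> 2 * \<bar>g x - c\<bar>" if s: "\<bar>s\<bar> \<le> \<tau>" for x s i
  proof -
    let ?e = "axis i (1::real) :: real ^ 'n"
    have "AE x in lborel. AE s in lborel. norm (gradient g (x + s *\<^sub>R ?e)) \<le> C * \<bar>g (x + s *\<^sub>R ?e) - c\<bar>"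
      by (rule AE_lebesgue_imp_AE_lines[OF ae])
    then have "AE x in lborel. \<bar>g (x + s *\<^sub>R ?e) - c\<bar> \<le> 2 * \<bar>g x - c\<bar>"
    proof eventually_elim
      case (elim x)
      define h where "h s = g (x + s *\<^sub>R ?e)" for s
      obtain N where N: "{s. \<not> norm (gradient g (x + s *\<^sub>R ?e)) \<le> C * \<bar>g (x + s *\<^sub>R ?e) - c\<bar>} \<subseteq> N"
          "N \<in> null_sets (lborel :: real measure)"
        using elim by (auto elim!: AE_E simp: null_sets_def)
      have "negligible N"
        using N(2) by (simp add: negligible_iff_null_sets null_sets_completionI)
      have lh: "L-lipschitz_on UNIV h"
      proof (rule lipschitz_onI)
        fix s r
        have "dist (x + s *\<^sub>R ?e) (x + r *\<^sub>R ?e) = dist s r"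
          by (simp add: dist_norm flip: scaleR_diff_left)
        then show "dist (h s) (h r) \<le> L * dist s r"
          using lipschitz_onD[OF lip, of "x + s *\<^sub>R ?e" "x + r *\<^sub>R ?e"] by (simp add: h_def)
      qed (rule lipschitz_on_nonneg[OF lip])
      have "\<bar>h s - c\<bar> \<le> 2 * \<bar>h 0 - c\<bar>"
      proof (rule deviation_doubles_at_most[OF lh \<open>negligible N\<close> \<open>0 \<le> C\<close> \<tau>(2) _ s])
        \<comment> \<open>Only points where the restriction to the line has a derivative matter
          here, so there the component of \<open>gradient\<close> is the true derivative and not an
          arbitrary value.\<close>
        fix r D assume r: "r \<notin> N" "(h has_real_derivative D) (at r)"
        have "((\<lambda>q. h (r + q)) has_real_derivative D) (at 0)"
          using r(2) DERIV_shift[of h D 0 r] by (simp add: add.commute)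
        then have "partial_deriv ?e g (x + r *\<^sub>R ?e) = D"
          unfolding partial_deriv_def h_def by (auto simp: algebra_simps intro: DERIV_imp_deriv)
        then have "\<bar>D\<bar> = \<bar>gradient g (x + r *\<^sub>R ?e) $ i\<bar>" by (simp add: gradient_def)
        also have "\<dots> \<le> norm (gradient g (x + r *\<^sub>R ?e))" by (rule component_le_norm_cart)
        also have "\<dots> \<le> C * \<bar>h r - c\<bar>" using r(1) N(1) by (auto simp: h_def)
        finally show "\<bar>D\<bar> \<le> C * \<bar>h r - c\<bar>" .
      qed
      then show ?case by (simp add: h_def)
    qed
    then have "AE x in lebesgue. \<not> 2 * \<bar>g x - c\<bar> < \<bar>g (x + s *\<^sub>R ?e) - c\<bar>"
      by (simp add: AE_completion_iff not_less)
    moreover let ?U = "{x. 2 * \<bar>g x - c\<bar> < \<bar>g (x + s *\<^sub>R ?e) - c\<bar>}"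
    have cont: "continuous_on UNIV g" by (rule lipschitz_on_continuous_on[OF lip])
    have "continuous_on UNIV (\<lambda>x. g (x + s *\<^sub>R ?e))"
      by (rule continuous_on_compose2[OF cont]) (auto intro!: continuous_intros)
    then have op: "open ?U" using cont by (intro open_Collect_less) (auto intro!: continuous_intros)
    ultimately have "negligible ?U"
      using op by (auto simp: negligible_iff_null_sets intro!: AE_iff_null_sets[THEN iffD2])
    then have "?U = {}" using op open_not_negligible by blast
    then show ?thesis by (auto simp: not_less)
  qed
  have line: "g (x + s *\<^sub>R axis i 1) = c" if "g x = c" for x s i
  proof -
    obtain n :: nat where n: "\<bar>s\<bar> / \<tau> \<le> real n" "0 < n"
      by (metis real_arch_simple less_Suc_eq_0_disj linorder_not_less nat_le_real_less le_SucI of_nat_le_iff order_trans zero_less_Suc le_cases)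
    define r where "r = s / real n"
    have r: "\<bar>r\<bar> \<le> \<tau>" using n \<tau>(1) by (simp add: r_def field_simps)
    have "g (x + (real k * r) *\<^sub>R axis i 1) = c" for k
    proof (induction k)
      case (Suc k)
      then show ?case using double[OF r, of "x + (real k * r) *\<^sub>R axis i 1" i]
        by (simp add: algebra_simps)
    qed (use that in simp)
    from this[of n] show ?thesis using n by (simp add: r_def)
  qed
  have "g (x1 + (\<Sum>i\<in>I. (x - x1) $ i *\<^sub>R axis i 1)) = c" if "finite I" for I
    using that
  proof induction
    case (insert i I)
    then show ?case
      using line[of "x1 + (\<Sum>i\<in>I. (x - x1) $ i *\<^sub>R axis i 1)" "(x - x1) $ i" i] by (simp add: ac_simps)
  qed (use x1 in simp)
  moreover have "(\<Sum>i\<in>UNIV. (x - x1) $ i *\<^sub>R axis i (1::real)) = x - x1"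
    using basis_expansion[of "x - x1"] by (simp add: scalar_mult_eq_scaleR)
  ultimately show ?thesis by (metis add_diff_cancel_left' diff_add_cancel add.commute finite_class.finite_UNIV)
qed

section \<open>Radial test functions\<close>

text \<open>Test functions $\alpha(t) + \beta(t)\, Q(|x - y|^2)$. Where $\beta Q' \neq 0$ the spatial gradient
  vanishes only at $x = y$; there the Hessian is a multiple of the identity, so the inf/sup over
  directions in the viscosity condition is harmless and both cases give the same inequality.\<close>

locale radial_test =
  fixes \<alpha> \<alpha>' \<alpha>'' \<beta> \<beta>' \<beta>'' Q Q' Q'' :: "real \<Rightarrow> real" and y :: "real ^ 'n"
  assumes \<alpha>: "\<And>t. (\<alpha> has_real_derivative \<alpha>' t) (at t)" "\<And>t. (\<alpha>' has_real_derivative \<alpha>'' t) (at t)"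
      "continuous_on UNIV \<alpha>''"
    and \<beta>: "\<And>t. (\<beta> has_real_derivative \<beta>' t) (at t)" "\<And>t. (\<beta>' has_real_derivative \<beta>'' t) (at t)"
      "continuous_on UNIV \<beta>''"
    and Q: "\<And>r. (Q has_real_derivative Q' r) (at r)" "\<And>r. (Q' has_real_derivative Q'' r) (at r)"
      "continuous_on UNIV Q''"
begin

definition \<phi> :: "(real ^ 'n) \<times> real \<Rightarrow> real" where
  "\<phi> z = \<alpha> (snd z) + \<beta> (snd z) * Q ((norm (fst z - y))\<^sup>2)"

text \<open>\<open>D b\<close> is the derivative of \<open>\<phi>\<close> along the space-time
  vector \<open>b\<close>, and \<open>DD b c\<close> that of \<open>D b\<close> along
  \<open>c\<close>. Arbitrary vectors cover the spatial, temporal and mixed derivatives in one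
  formula.\<close>

definition D :: "(real ^ 'n) \<times> real \<Rightarrow> (real ^ 'n) \<times> real \<Rightarrow> real" where
  "D b z = snd b * (\<alpha>' (snd z) + \<beta>' (snd z) * Q ((norm (fst z - y))\<^sup>2)) +
     \<beta> (snd z) * Q' ((norm (fst z - y))\<^sup>2) * (2 * ((fst z - y) \<bullet> fst b))"

definition DD :: "(real ^ 'n) \<times> real \<Rightarrow> (real ^ 'n) \<times> real \<Rightarrow> (real ^ 'n) \<times> real \<Rightarrow> real" where
  "DD b c z = snd b * (snd c * (\<alpha>'' (snd z) + \<beta>'' (snd z) * Q ((norm (fst z - y))\<^sup>2)) +
       \<beta>' (snd z) * Q' ((norm (fst z - y))\<^sup>2) * (2 * ((fst z - y) \<bullet> fst c))) +
     snd c * \<beta>' (snd z) * Q' ((norm (fst z - y))\<^sup>2) * (2 * ((fst z - y) \<bullet> fst b)) +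
     \<beta> (snd z) * Q'' ((norm (fst z - y))\<^sup>2) * (2 * ((fst z - y) \<bullet> fst c)) * (2 * ((fst z - y) \<bullet> fst b)) +
     \<beta> (snd z) * Q' ((norm (fst z - y))\<^sup>2) * (2 * (fst c \<bullet> fst b))"

lemma has_derivative_along_line:
  shows "((\<lambda>s. snd (z + s *\<^sub>R b)) has_real_derivative snd b) (at 0)"
    and "((\<lambda>s. (norm (fst (z + s *\<^sub>R b) - y))\<^sup>2) has_real_derivative 2 * ((fst z - y) \<bullet> fst b)) (at 0)"
    and "((\<lambda>s. (fst (z + s *\<^sub>R b) - y) \<bullet> v) has_real_derivative fst b \<bullet> v) (at 0)"
proof -
  show "((\<lambda>s. snd (z + s *\<^sub>R b)) has_real_derivative snd b) (at 0)"
    by (auto intro!: derivative_eq_intros)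
  have "(norm (d + s *\<^sub>R v))\<^sup>2 = d \<bullet> d + s * (2 * (d \<bullet> v)) + s\<^sup>2 * (v \<bullet> v)" for d v :: "real ^ 'n" and s
    unfolding power2_norm_eq_inner
    by (simp add: inner_add_left inner_add_right inner_commute power2_eq_square algebra_simps)
  from this[of "fst z - y" _ "fst b"]
  have "(norm (fst (z + s *\<^sub>R b) - y))\<^sup>2 =
      (fst z - y) \<bullet> (fst z - y) + s * (2 * ((fst z - y) \<bullet> fst b)) + s\<^sup>2 * (fst b \<bullet> fst b)" for s
    by (simp add: add_diff_eq diff_add_eq)
  then show "((\<lambda>s. (norm (fst (z + s *\<^sub>R b) - y))\<^sup>2) has_real_derivative 2 * ((fst z - y) \<bullet> fst b)) (at 0)"
    by (auto intro!: derivative_eq_intros)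
  have "(fst (z + s *\<^sub>R b) - y) \<bullet> v = (fst z - y) \<bullet> v + s * (fst b \<bullet> v)" for s
    by (simp add: inner_add_left inner_diff_left algebra_simps)
  then show "((\<lambda>s. (fst (z + s *\<^sub>R b) - y) \<bullet> v) has_real_derivative fst b \<bullet> v) (at 0)"
    by (auto intro!: derivative_eq_intros)
qed

text \<open>The value of \<open>k\<close> at 0 is a side condition, so that derivatives are stated
  at \<open>snd z\<close> rather than at \<open>snd (z + 0 *\<^sub>R b)\<close>.\<close>

lemma DERIV_chain_at_0:
  fixes g k :: "real \<Rightarrow> real"
  assumes "\<And>t. (g has_real_derivative g' t) (at t)" "(k has_real_derivative m) (at 0)" "k 0 = k0"
  shows "((\<lambda>s. g (k s)) has_real_derivative g' k0 * m) (at 0)"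
  using DERIV_chain2[OF assms(1) assms(2)] assms(3) by simp

lemma has_D: "((\<lambda>s. \<phi> (z + s *\<^sub>R b)) has_real_derivative D b z) (at 0)"
proof -
  note t = has_derivative_along_line(1)[of z b] and n = has_derivative_along_line(2)[of z b]
  have "((\<lambda>s. \<phi> (z + s *\<^sub>R b)) has_real_derivative
     \<alpha>' (snd z) * snd b + (\<beta>' (snd z) * snd b * Q ((norm (fst (z + 0 *\<^sub>R b) - y))\<^sup>2) +
       Q' ((norm (fst z - y))\<^sup>2) * (2 * ((fst z - y) \<bullet> fst b)) * \<beta> (snd (z + 0 *\<^sub>R b)))) (at 0)"
    unfolding \<phi>_def
    by (intro DERIV_add DERIV_mult DERIV_chain_at_0[OF \<alpha>(1) t] DERIV_chain_at_0[OF \<beta>(1) t] DERIV_chain_at_0[OF Q(1) n]) auto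
  then show ?thesis by (rule DERIV_cong) (simp add: D_def algebra_simps)
qed

lemma has_DD: "((\<lambda>s. D b (z + s *\<^sub>R c)) has_real_derivative DD b c z) (at 0)"
proof -
  note t = has_derivative_along_line(1)[of z c] and n = has_derivative_along_line(2)[of z c] and i = has_derivative_along_line(3)[of z c "fst b"]
  have "((\<lambda>s. D b (z + s *\<^sub>R c)) has_real_derivative
     (snd b * (\<alpha>'' (snd z) * snd c + (\<beta>'' (snd z) * snd c * Q ((norm (fst (z + 0 *\<^sub>R c) - y))\<^sup>2) +
       Q' ((norm (fst z - y))\<^sup>2) * (2 * ((fst z - y) \<bullet> fst c)) * \<beta>' (snd (z + 0 *\<^sub>R c)))) +
     ((\<beta>' (snd z) * snd c * Q' ((norm (fst (z + 0 *\<^sub>R c) - y))\<^sup>2) +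
       Q'' ((norm (fst z - y))\<^sup>2) * (2 * ((fst z - y) \<bullet> fst c)) * \<beta> (snd (z + 0 *\<^sub>R c))) * (2 * ((fst (z + 0 *\<^sub>R c) - y) \<bullet> fst b)) +
       (2 * (fst c \<bullet> fst b)) * (\<beta> (snd (z + 0 *\<^sub>R c)) * Q' ((norm (fst (z + 0 *\<^sub>R c) - y))\<^sup>2))))) (at 0)"
    unfolding D_def
    by (intro DERIV_add DERIV_mult DERIV_cmult DERIV_chain_at_0[OF \<alpha>(2) t] DERIV_chain_at_0[OF \<beta>(1) t] DERIV_chain_at_0[OF \<beta>(2) t]
        DERIV_chain_at_0[OF Q(1) n] DERIV_chain_at_0[OF Q(2) n] i) auto
  then show ?thesis by (rule DERIV_cong) (simp add: DD_def algebra_simps)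
qed

lemma partial_deriv_\<phi>: "partial_deriv b \<phi> = D b"
  unfolding partial_deriv_def by (rule ext, rule DERIV_imp_deriv, rule has_D)

lemma partial_deriv_D: "partial_deriv c (D b) = DD b c"
  unfolding partial_deriv_def by (rule ext, rule DERIV_imp_deriv, rule has_DD)

lemma continuous_on_compose_UNIV:
  fixes h :: "real \<Rightarrow> real"
  assumes "continuous_on UNIV h" "continuous_on S k"
  shows "continuous_on S (\<lambda>z. h (k z))"
  using continuous_on_compose2[OF assms(1,2)] by simp

lemma continuous_coefficients:
  "continuous_on UNIV \<alpha>" "continuous_on UNIV \<alpha>'" "continuous_on UNIV \<beta>" "continuous_on UNIV \<beta>'"
  "continuous_on UNIV Q" "continuous_on UNIV Q'"
  by (rule DERIV_continuous_on, rule has_field_derivative_at_within, rule \<alpha> \<beta> Q)+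

lemma C2_on_\<phi>: "C2_on S \<phi>"
proof -
  note c = continuous_coefficients[THEN continuous_on_compose_UNIV] \<alpha>(3)[THEN continuous_on_compose_UNIV]
    \<beta>(3)[THEN continuous_on_compose_UNIV] Q(3)[THEN continuous_on_compose_UNIV]
  have 0: "continuous_on S \<phi>" unfolding \<phi>_def by (intro continuous_intros c)
  have 1: "continuous_on S (D b)" for b unfolding D_def by (intro continuous_intros c)
  have 2: "continuous_on S (DD b b')" for b b' unfolding DD_def by (intro continuous_intros c)
  show ?thesis
    unfolding C2_on_def C1_on_def partial_deriv_\<phi> partial_deriv_D
    by (intro conjI ballI 0 1 2) (rule differentiableI, rule has_field_derivative_imp_has_derivative, rule has_D has_DD)+
qed

lemma space_gradient_\<phi>:
  "space_gradient \<phi> z = (2 * \<beta> (snd z) * Q' ((norm (fst z - y))\<^sup>2)) *\<^sub>R (fst z - y)"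
proof (rule vec_eq_iff[THEN iffD2], rule allI)
  fix i
  have "space_gradient \<phi> z $ i = partial_deriv (axis i 1, 0) \<phi> z"
    by (simp add: space_gradient_def gradient_def partial_deriv_def plus_prod_def scaleR_prod_def)
  then show "space_gradient \<phi> z $ i = ((2 * \<beta> (snd z) * Q' ((norm (fst z - y))\<^sup>2)) *\<^sub>R (fst z - y)) $ i"
    by (simp add: partial_deriv_\<phi> D_def inner_axis)
qed

lemma time_deriv_\<phi>: "time_deriv \<phi> z = \<alpha>' (snd z) + \<beta>' (snd z) * Q ((norm (fst z - y))\<^sup>2)"
  by (simp add: time_deriv_def partial_deriv_\<phi> D_def)

lemma space_hessian_\<phi>:
  "space_hessian \<phi> z $ i $ j =
     4 * \<beta> (snd z) * Q'' ((norm (fst z - y))\<^sup>2) * ((fst z - y) $ i * (fst z - y) $ j) +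
     2 * \<beta> (snd z) * Q' ((norm (fst z - y))\<^sup>2) * of_bool (i = j)"
proof -
  have 1: "d \<bullet> axis k 1 = d $ k" for d :: "real ^ 'n" and k by (simp add: inner_axis)
  have 2: "axis k 1 \<bullet> (axis l 1 :: real ^ 'n) = of_bool (l = k)" for k l by (simp add: inner_axis_axis)
  show ?thesis
    unfolding space_hessian_def vec_lambda_beta partial_deriv_\<phi> partial_deriv_D DD_def fst_conv snd_conv 2 1
    by (simp add: algebra_simps axis_def)
qed

end

text \<open>The second factor is the shape of the Hessian of a radial function. Contracting it with
  the identity gives traces; contracting it with the rank one matrix of a unit vector
  \<open>a\<close> gives the square of the inner product of \<open>a\<close> and \<open>d\<close>
  and the norm of \<open>a\<close>, which is 1.\<close>

lemma sum_diffusion_matrix: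
  fixes a d :: "real ^ 'n"
  assumes "norm a = 1"
  shows "(\<Sum>i\<in>UNIV. \<Sum>j\<in>UNIV. (of_bool (i = j) + k * (a $ i * a $ j)) * (A * (d $ i * d $ j) + B * of_bool (i = j)))
    = A * ((norm d)\<^sup>2 + k * (a \<bullet> d)\<^sup>2) + B * (real CARD('n) + k)"
proof -
  have aa: "(\<Sum>i\<in>UNIV. a $ i * a $ i) = 1"
    using assms by (metis norm_eq_1 inner_vec_def inner_real_def sum.cong)
  have \<delta>: "(\<Sum>j\<in>UNIV. of_bool (i = j) * X j) = X i" for X :: "'n \<Rightarrow> real" and i
  proof -
    have "(\<Sum>j\<in>UNIV. of_bool (i = j) * X j) = (\<Sum>j\<in>UNIV. if i = j then X j else 0)"
      by (intro sum.cong) auto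
    then show ?thesis by simp
  qed
  have \<gamma>: "(\<Sum>i\<in>UNIV. \<Sum>j\<in>UNIV. m * (v i * v j)) = m * ((\<Sum>i\<in>UNIV. v i) * (\<Sum>j\<in>UNIV. v j))"
    for m :: real and v :: "'n \<Rightarrow> real"
    unfolding sum_product by (simp only: sum_distrib_left)
  have dd: "(\<Sum>i\<in>UNIV. d $ i * d $ i) = (norm d)\<^sup>2"
    by (simp add: power2_norm_eq_inner inner_vec_def)
  have "(\<Sum>i\<in>UNIV. \<Sum>j\<in>UNIV. (of_bool (i = j) + k * (a $ i * a $ j)) * (A * (d $ i * d $ j) + B * of_bool (i = j)))
    = (\<Sum>i\<in>UNIV. \<Sum>j\<in>UNIV. of_bool (i = j) * (A * (d $ i * d $ j))
        + of_bool (i = j) * B + A * k * ((a $ i * d $ i) * (a $ j * d $ j)) + of_bool (i = j) * (B * k * (a $ i * a $ j)))"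
    by (intro sum.cong refl) (auto simp: algebra_simps)
  also have "\<dots> = A * (\<Sum>i\<in>UNIV. d $ i * d $ i) + B * real CARD('n)
       + A * k * ((\<Sum>i\<in>UNIV. a $ i * d $ i) * (\<Sum>j\<in>UNIV. a $ j * d $ j)) + B * k * (\<Sum>i\<in>UNIV. a $ i * a $ i)"
    unfolding sum.distrib \<delta> \<gamma> by (simp add: sum_distrib_left)
  also have "(\<Sum>i\<in>UNIV. a $ i * d $ i) = a \<bullet> d" by (simp add: inner_vec_def)
  finally show ?thesis unfolding aa dd by (simp add: power2_eq_square algebra_simps)
qed

context radial_test
begin

text \<open>The gradient is parallel to fst z - y, so the inner product in the contraction has full
  size and the weights 1 and p - 2 combine to p - 1 in the radial direction.\<close>

lemma p_diffusion_\<phi>: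
  assumes "space_gradient \<phi> z \<noteq> 0"
  shows "p_diffusion p \<phi> z = \<beta> (snd z) * (4 * Q'' ((norm (fst z - y))\<^sup>2) * (p - 1) * (norm (fst z - y))\<^sup>2 +
     2 * Q' ((norm (fst z - y))\<^sup>2) * (real CARD('n) + p - 2))"
proof -
  define d where "d = fst z - y"
  define c where "c = 2 * \<beta> (snd z) * Q' ((norm d)\<^sup>2)"
  define a where "a = (1 / norm (c *\<^sub>R d)) *\<^sub>R (c *\<^sub>R d)"
  have G: "space_gradient \<phi> z = c *\<^sub>R d" by (simp add: space_gradient_\<phi> d_def c_def)
  then have nz: "c \<noteq> 0" "d \<noteq> 0" using assms by auto
  have a1: "norm a = 1" using nz by (simp add: a_def)
  have "space_gradient \<phi> z $ i * space_gradient \<phi> z $ j / (norm (space_gradient \<phi> z))\<^sup>2 = a $ i * a $ j" for i j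
    unfolding G a_def by (simp add: power2_eq_square)
  then have "p_diffusion p \<phi> z = (\<Sum>i\<in>UNIV. \<Sum>j\<in>UNIV. (of_bool (i = j) + (p - 2) * (a $ i * a $ j)) *
      (4 * \<beta> (snd z) * Q'' ((norm d)\<^sup>2) * (d $ i * d $ j) + c * of_bool (i = j)))"
    unfolding p_diffusion_def space_hessian_\<phi> d_def[symmetric] c_def[symmetric] by simp
  also have "\<dots> = 4 * \<beta> (snd z) * Q'' ((norm d)\<^sup>2) * ((norm d)\<^sup>2 + (p - 2) * (a \<bullet> d)\<^sup>2) + c * (real CARD('n) + (p - 2))"
    by (rule sum_diffusion_matrix[OF a1])
  also have "(a \<bullet> d)\<^sup>2 = (norm d)\<^sup>2"
    using nz by (simp add: a_def power_mult_distrib power_divide dot_square_norm power2_eq_square)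
  finally show ?thesis unfolding d_def[symmetric] c_def by algebra
qed

lemma p_diffusion_dir_\<phi>:
  assumes "fst z = y" "norm a = 1"
  shows "p_diffusion_dir p a \<phi> z = \<beta> (snd z) * (2 * Q' 0 * (real CARD('n) + p - 2))"
proof -
  \<comment> \<open>The vanishing first summand is kept so that the contraction formula matches with
    \<open>A\<close> and \<open>d\<close> equal to 0.\<close>
  have "space_hessian \<phi> z $ i $ j = 0 * (0 $ i * 0 $ j) + 2 * \<beta> (snd z) * Q' 0 * of_bool (i = j)" for i j
    unfolding space_hessian_\<phi> assms(1) by simp
  then show ?thesis
    unfolding p_diffusion_dir_def by (simp only: sum_diffusion_matrix[OF assms(2)]) simp
qed

lemma supersolution_test:
  assumes "viscosity_supersolution p f T u" and "local_min_at (UNIV \<times> {0<..<T}) (\<lambda>w. u w - \<phi> w) z"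
    and nz: "\<beta> (snd z) * Q' ((norm (fst z - y))\<^sup>2) \<noteq> 0"
  shows "\<beta> (snd z) * (4 * Q'' ((norm (fst z - y))\<^sup>2) * (p - 1) * (norm (fst z - y))\<^sup>2 +
       2 * Q' ((norm (fst z - y))\<^sup>2) * (real CARD('n) + p - 2))
     \<le> \<alpha>' (snd z) + \<beta>' (snd z) * Q ((norm (fst z - y))\<^sup>2)
       + pow_two_minus p (2 * \<bar>\<beta> (snd z) * Q' ((norm (fst z - y))\<^sup>2)\<bar> * norm (fst z - y)) * f (u z)"
proof -
  have N: "norm (space_gradient \<phi> z) = 2 * \<bar>\<beta> (snd z) * Q' ((norm (fst z - y))\<^sup>2)\<bar> * norm (fst z - y)"
    by (simp add: space_gradient_\<phi> abs_mult)
  have v: "(space_gradient \<phi> z \<noteq> 0 \<longrightarrow>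
           time_deriv \<phi> z + pow_two_minus p (norm (space_gradient \<phi> z)) * f (u z)
             \<ge> p_diffusion p \<phi> z) \<and>
        (space_gradient \<phi> z = 0 \<longrightarrow>
           (SUP a\<in>sphere 0 1. time_deriv \<phi> z
              + pow_two_minus p (norm (space_gradient \<phi> z)) * f (u z)
              - p_diffusion_dir p a \<phi> z) \<ge> 0)"
    using assms C2_on_\<phi> unfolding viscosity_supersolution_def by blast
  show ?thesis
  proof (cases "space_gradient \<phi> z = 0")
    case False
    then show ?thesis using v unfolding p_diffusion_\<phi>[OF False] time_deriv_\<phi> N by simp
  next
    case True
    then have y: "fst z = y" using nz by (auto simp: space_gradient_\<phi>)
    have ne: "sphere (0 :: real ^ 'n) 1 \<noteq> {}" by simp
    have "(SUP a\<in>sphere 0 1. time_deriv \<phi> z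
              + pow_two_minus p (norm (space_gradient \<phi> z)) * f (u z)
              - p_diffusion_dir p a \<phi> z) =
          (SUP a\<in>sphere (0 :: real ^ 'n) 1. time_deriv \<phi> z
              + pow_two_minus p (norm (space_gradient \<phi> z)) * f (u z)
              - \<beta> (snd z) * (2 * Q' 0 * (real CARD('n) + p - 2)))"
      using y by (intro SUP_cong refl) (simp add: p_diffusion_dir_\<phi>)
    then show ?thesis using v True ne y N by (simp only: time_deriv_\<phi> cSUP_const cINF_const) simp
  qed
qed

lemma subsolution_test:
  assumes "viscosity_subsolution p f T u" and "local_max_at (UNIV \<times> {0<..<T}) (\<lambda>w. u w - \<phi> w) z"
    and nz: "\<beta> (snd z) * Q' ((norm (fst z - y))\<^sup>2) \<noteq> 0"
  shows "\<alpha>' (snd z) + \<beta>' (snd z) * Q ((norm (fst z - y))\<^sup>2)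
       + pow_two_minus p (2 * \<bar>\<beta> (snd z) * Q' ((norm (fst z - y))\<^sup>2)\<bar> * norm (fst z - y)) * f (u z)
     \<le> \<beta> (snd z) * (4 * Q'' ((norm (fst z - y))\<^sup>2) * (p - 1) * (norm (fst z - y))\<^sup>2 +
       2 * Q' ((norm (fst z - y))\<^sup>2) * (real CARD('n) + p - 2))"
proof -
  have N: "norm (space_gradient \<phi> z) = 2 * \<bar>\<beta> (snd z) * Q' ((norm (fst z - y))\<^sup>2)\<bar> * norm (fst z - y)"
    by (simp add: space_gradient_\<phi> abs_mult)
  have v: "(space_gradient \<phi> z \<noteq> 0 \<longrightarrow>
           time_deriv \<phi> z + pow_two_minus p (norm (space_gradient \<phi> z)) * f (u z)
             \<le> p_diffusion p \<phi> z) \<and>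
        (space_gradient \<phi> z = 0 \<longrightarrow>
           (INF a\<in>sphere 0 1. time_deriv \<phi> z
              + pow_two_minus p (norm (space_gradient \<phi> z)) * f (u z)
              - p_diffusion_dir p a \<phi> z) \<le> 0)"
    using assms C2_on_\<phi> unfolding viscosity_subsolution_def by blast
  show ?thesis
  proof (cases "space_gradient \<phi> z = 0")
    case False
    then show ?thesis using v unfolding p_diffusion_\<phi>[OF False] time_deriv_\<phi> N by simp
  next
    case True
    then have y: "fst z = y" using nz by (auto simp: space_gradient_\<phi>)
    have ne: "sphere (0 :: real ^ 'n) 1 \<noteq> {}" by simp
    have "(INF a\<in>sphere 0 1. time_deriv \<phi> z
              + pow_two_minus p (norm (space_gradient \<phi> z)) * f (u z)
              - p_diffusion_dir p a \<phi> z) =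
          (INF a\<in>sphere (0 :: real ^ 'n) 1. time_deriv \<phi> z
              + pow_two_minus p (norm (space_gradient \<phi> z)) * f (u z)
              - \<beta> (snd z) * (2 * Q' 0 * (real CARD('n) + p - 2)))"
      using y by (intro INF_cong refl) (simp add: p_diffusion_dir_\<phi>)
    then show ?thesis using v True ne y N by (simp only: time_deriv_\<phi> cSUP_const cINF_const) simp
  qed
qed

end

text \<open>Both \<open>u\<close> (with \<open>f\<close>) and \<open>- u\<close> (with \<open>- f (- r)\<close>) satisfy this, so that upper and lower bounds on \<open>u\<close>
  need only one proof.\<close>

definition radial_supersolution ::
    "real \<Rightarrow> (real \<Rightarrow> real) \<Rightarrow> real \<Rightarrow> ((real ^ 'n) \<times> real \<Rightarrow> real) \<Rightarrow> bool" where
  "radial_supersolution p f T v \<longleftrightarrow>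
     (\<forall>\<alpha> \<alpha>' \<alpha>'' \<beta> \<beta>' \<beta>'' Q Q' Q'' y x t. radial_test \<alpha> \<alpha>' \<alpha>'' \<beta> \<beta>' \<beta>'' Q Q' Q'' \<longrightarrow>
        local_min_at (UNIV \<times> {0<..<T})
          (\<lambda>w. v w - (\<alpha> (snd w) + \<beta> (snd w) * Q ((norm (fst w - y))\<^sup>2))) (x, t) \<longrightarrow>
        \<beta> t * Q' ((norm (x - y))\<^sup>2) \<noteq> 0 \<longrightarrow>
        \<beta> t * (4 * Q'' ((norm (x - y))\<^sup>2) * (p - 1) * (norm (x - y))\<^sup>2 +
          2 * Q' ((norm (x - y))\<^sup>2) * (real CARD('n) + p - 2))
        \<le> \<alpha>' t + \<beta>' t * Q ((norm (x - y))\<^sup>2)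
          + pow_two_minus p (2 * \<bar>\<beta> t * Q' ((norm (x - y))\<^sup>2)\<bar> * norm (x - y)) * f (v (x, t)))"

lemma viscosity_supersolution_imp_radial:
  "viscosity_supersolution p f T u \<Longrightarrow> radial_supersolution p f T u"
  unfolding radial_supersolution_def
proof (intro allI impI, goal_cases)
  case (1 \<alpha> \<alpha>' \<alpha>'' \<beta> \<beta>' \<beta>'' Q Q' Q'' y x t)
  interpret radial_test \<alpha> \<alpha>' \<alpha>'' \<beta> \<beta>' \<beta>'' Q Q' Q'' y by (rule 1(2))
  from supersolution_test[OF 1(1), of "(x, t)", unfolded fst_conv snd_conv \<phi>_def] 1(3,4)
  show ?case by blast
qed

text \<open>Touching -u from below by a radial function is touching u from above by its negative.
  Negating \<alpha> and \<beta> while keeping \<open>Q\<close> stays within the radial family, and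
  the sign changes on both sides of the inequality cancel.\<close>

lemma viscosity_subsolution_imp_radial:
  fixes u :: "(real ^ 'n) \<times> real \<Rightarrow> real"
  shows "viscosity_subsolution p f T u \<Longrightarrow> radial_supersolution p (\<lambda>r. - f (- r)) T (\<lambda>z. - u z)"
  unfolding radial_supersolution_def
proof (intro allI impI, goal_cases)
  case (1 \<alpha> \<alpha>' \<alpha>'' \<beta> \<beta>' \<beta>'' Q Q' Q'' y x t)
  interpret radial_test \<alpha> \<alpha>' \<alpha>'' \<beta> \<beta>' \<beta>'' Q Q' Q'' y by (rule 1(2))
  interpret neg: radial_test "\<lambda>t. - \<alpha> t" "\<lambda>t. - \<alpha>' t" "\<lambda>t. - \<alpha>'' t" "\<lambda>t. - \<beta> t" "\<lambda>t. - \<beta>' t" "\<lambda>t. - \<beta>'' t" Q Q' Q'' y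
    by (unfold_locales; (rule Q | (rule DERIV_minus, rule \<alpha> \<beta>) | (rule continuous_on_minus, rule \<alpha> \<beta>)))
  have "local_max_at (UNIV \<times> {0<..<T}) (\<lambda>w. u w - neg.\<phi> w) (x, t)"
    using 1(3) unfolding neg.\<phi>_def local_min_at_def local_max_at_def by (auto elim!: eventually_mono)
  note key = neg.subsolution_test[OF 1(1) this, unfolded fst_conv snd_conv]
  have "- \<beta> t * Q' ((norm (x - y))\<^sup>2) \<noteq> 0" using 1(4) by simp
  from key[OF this] show ?case
    unfolding mult_minus_left minus_minus abs_minus_cancel mult_minus_right by linarith
qed

section \<open>Minimum principles\<close>

lemma pow_two_minus_bounds:
  assumes "p \<le> 2" "0 \<le> r" "r \<le> 1"
  shows "0 \<le> pow_two_minus p r" "pow_two_minus p r \<le> 1"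
  using assms by (auto simp: pow_two_minus_def intro: powr_le1)

lemma local_min_atI:
  assumes "open N" "z \<in> N" "z \<in> S" "\<And>w. w \<in> N \<Longrightarrow> h z \<le> h w"
  shows "local_min_at S h z"
  using assms unfolding local_min_at_def eventually_at_topological by blast

text \<open>The top slice counts as boundary because the viscosity inequalities are available only
  at local extrema in an open time interval; the barriers must therefore also be controlled
  there.\<close>

lemma interior_negative_minimum:
  fixes Z :: "(real ^ 'n) \<times> real \<Rightarrow> real"
  assumes cont: "continuous_on (cball y R \<times> {0..T1}) Z"
    and neg: "x1 \<in> cball y R" "t1 \<in> {0..T1}" "Z (x1, t1) < 0"
    and bdry: "\<And>x t. \<lbrakk>dist y x \<le> R; 0 \<le> t; t \<le> T1; dist y x = R \<or> t = 0 \<or> t = T1\<rbrakk> \<Longrightarrow> 0 \<le> Z (x, t)"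
  shows "\<exists>x t. dist y x < R \<and> 0 < t \<and> t < T1 \<and> Z (x, t) < 0 \<and>
    (\<forall>w\<in>ball y R \<times> {0<..<T1}. Z (x, t) \<le> Z w)"
proof -
  let ?K = "cball y R \<times> {0..T1}"
  have "\<exists>z\<in>?K. \<forall>w\<in>?K. Z z \<le> Z w"
    by (intro continuous_attains_inf[OF _ _ cont] compact_Times compact_cball compact_Icc) (use neg in blast)
  then obtain z where z: "z \<in> ?K" "\<And>w. w \<in> ?K \<Longrightarrow> Z z \<le> Z w" by blast
  obtain x t where xt: "z = (x, t)" by fastforce
  have "Z (x, t) < 0" using z(2)[of "(x1, t1)"] neg xt by auto
  moreover from this have "dist y x < R" "0 < t" "t < T1"
    using bdry[of x t] z(1) xt by force+
  moreover have "Z (x, t) \<le> Z w" if "w \<in> ball y R \<times> {0<..<T1}" for w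
    using z(2)[of w] xt that by (cases w) auto
  ultimately show ?thesis by blast
qed

text \<open>Carries what is proved inside the open time interval over to its endpoints, in
  particular to a point at the final time.\<close>

lemma nonneg_at_closed_interval:
  fixes h :: "real \<Rightarrow> real"
  assumes "continuous_on {0..T} h" "0 < T" "\<And>s. \<lbrakk>0 < s; s < T\<rbrakk> \<Longrightarrow> 0 \<le> h s" "t \<in> {0..T}"
  shows "0 \<le> h t"
proof -
  have cl: "closure {0<..<T} = {0..T}" using \<open>0 < T\<close> by simp
  show ?thesis
    by (rule continuous_ge_on_closure[of "{0<..<T}" h t 0]) (use assms cl in auto)
qed

lemma continuous_on_time_slice:
  assumes "continuous_on (UNIV \<times> {0..T}) v"
  shows "continuous_on {0..T} (\<lambda>s. v (x, s))"
  by (rule continuous_on_compose2[OF assms]) (auto intro!: continuous_intros)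

text \<open>A smooth barrier touches \<open>v\<close> from below where \<open>v\<close> lies a depth
  \<Psi> below \<open>c\<close>. There the lower order term is at most K \<Psi>, the time derivative
  contributes at most -\<Lambda> \<Psi>, and the diffusion costs at most 2 n \<Psi>, so a large
  \<Lambda> contradicts the supersolution inequality.\<close>

lemma radial_supersolution_weak_minimum:
  fixes v :: "(real ^ 'n) \<times> real \<Rightarrow> real"
  assumes p: "1 < p" "p \<le> 2" and T: "0 < T"
    and cont: "continuous_on (UNIV \<times> {0..T}) v"
    and bnd: "\<And>x t. t \<in> {0..T} \<Longrightarrow> \<bar>v (x, t) - c\<bar> \<le> B"
    and rad: "radial_supersolution p f T v"
    and fK: "\<And>r. \<bar>r - c\<bar> \<le> B \<Longrightarrow> \<bar>f r\<bar> \<le> K * \<bar>r - c\<bar>" and K: "0 \<le> K"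
    and init: "\<And>x. c \<le> v (x, 0)" and t: "t \<in> {0..T}"
  shows "c \<le> v (x, t)"
proof -
  have "0 \<le> v (x1, t1) - c" if t1: "0 < t1" "t1 < T" for x1 t1
  proof (rule ccontr)
    assume "\<not> 0 \<le> v (x1, t1) - c"
    then have neg: "v (x1, t1) - c < 0" by simp
    have B: "0 \<le> B" using bnd[of t1 x1] t1 by auto
    define n where "n = real CARD('n)"
    \<comment> \<open>\<open>K\<close> pays for the lower order term, 2 n for the diffusion, and 1
      for strictness.\<close>
    define \<Lambda> where "\<Lambda> = K + 2 * n + 1"
    have \<Lambda>: "0 \<le> \<Lambda>" using K by (simp add: \<Lambda>_def n_def)
    define a where "a = - exp (- \<Lambda> * t1) * (v (x1, t1) - c)"
    have a: "0 < a" using neg by (simp add: a_def mult_pos_neg)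
    \<comment> \<open>The first bound keeps the penalty at (x1, t1) below \<open>a\<close>, so that
      \<open>Z\<close> is negative there; the second makes the gradient of the barrier at most 1 at
      the minimum. B + 1 avoids a zero denominator.\<close>
    define \<epsilon> where "\<epsilon> = min (a / (2 * (2 + (norm x1)\<^sup>2))) (1 / (4 * exp (2 * \<Lambda> * T) * (B + 1)))"
    have \<epsilon>: "0 < \<epsilon>" using a B by (auto simp: \<epsilon>_def intro!: divide_pos_pos mult_pos_pos add_pos_nonneg)
    have "\<epsilon> * (2 + (norm x1)\<^sup>2) \<le> a / (2 * (2 + (norm x1)\<^sup>2)) * (2 + (norm x1)\<^sup>2)"
      by (intro mult_right_mono) (auto simp: \<epsilon>_def)
    also have "\<dots> = a / 2"
    proof -
      have "2 + (norm x1)\<^sup>2 \<noteq> 0" by (metis add_nonneg_eq_0_iff zero_le_power2 zero_le_numeral zero_neq_numeral)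
      then show ?thesis by (simp add: field_simps)
    qed
    finally have \<epsilon>1: "\<epsilon> * (2 + (norm x1)\<^sup>2) < a" using a by simp
    have "4 * exp (2 * \<Lambda> * T) * (\<epsilon> * B) \<le> 4 * exp (2 * \<Lambda> * T) * (1 / (4 * exp (2 * \<Lambda> * T) * (B + 1)) * (B + 1))"
      using B \<epsilon> by (intro mult_left_mono mult_mono) (auto simp: \<epsilon>_def)
    also have "\<dots> = 1"
    proof -
      have "B + 1 \<noteq> 0" using B by simp
      then show ?thesis by simp
    qed
    finally have \<epsilon>2: "4 * exp (2 * \<Lambda> * T) * (\<epsilon> * B) \<le> 1" .
    define T1 where "T1 = (t1 + T) / 2"
    have T1: "t1 < T1" "T1 < T" using t1 by (auto simp: T1_def)
    \<comment> \<open>From exp r \<ge> 1 + r, the penalty at time \<open>T1\<close> is then at least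
      \<open>B\<close>, which outweighs any negative value of v - c.\<close>
    define m where "m = B / (\<epsilon> * (T1 - t1))"
    have m: "0 \<le> m" using B \<epsilon> T1 by (simp add: m_def)
    have "B = \<epsilon> * (m * (T1 - t1))" using \<epsilon> T1 by (simp add: m_def)
    also have "\<dots> \<le> \<epsilon> * exp (m * (T1 - t1))"
      using \<epsilon> exp_ge_add_one_self[of "m * (T1 - t1)"] by (intro mult_left_mono; linarith)
    finally have mB: "B \<le> \<epsilon> * exp (m * (T1 - t1))" .
    \<comment> \<open>The ball contains \<open>x1\<close>, and since R \<ge> 1 and R \<ge> B /
      \<epsilon> the quadratic penalty is at least \<open>B\<close> on the lateral boundary.\<close>
    define R where "R = norm x1 + B / \<epsilon> + 1"
    have R1: "1 \<le> R" "B / \<epsilon> \<le> R" using B \<epsilon> by (auto simp: R_def)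
    have "B = \<epsilon> * (B / \<epsilon>)" using \<epsilon> by simp
    also have "\<dots> \<le> \<epsilon> * R" using R1 \<epsilon> by (intro mult_left_mono) auto
    also have "\<dots> \<le> \<epsilon> * R\<^sup>2" using R1 \<epsilon> by (intro mult_left_mono) (auto simp: power2_eq_square)
    finally have RB: "B \<le> \<epsilon> * R\<^sup>2" .
    \<comment> \<open>\<open>|x|\<^sup>2\<close> forces the minimum into a ball, \<open>exp (m * (t - t1))\<close> keeps it away from the final
      time, and at the minimum \<open>\<epsilon> * |x|\<^sup>2 \<le> B\<close> keeps the gradient of the barrier below 1.\<close>
    define Z where "Z z = exp (- \<Lambda> * snd z) * (v z - c) + \<epsilon> * (1 + (norm (fst z))\<^sup>2 + exp (m * (snd z - t1)))" for z
    have low: "- B \<le> exp (- \<Lambda> * t) * (v (x, t) - c)" if "t \<in> {0..T}" for x t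
    proof -
      have "\<bar>exp (- \<Lambda> * t) * (v (x, t) - c)\<bar> \<le> 1 * B"
        unfolding abs_mult using that \<Lambda> bnd[OF that] by (intro mult_mono) auto
      then show ?thesis by simp
    qed
    have "\<exists>x t. dist 0 x < R \<and> 0 < t \<and> t < T1 \<and> Z (x, t) < 0 \<and>
      (\<forall>w\<in>ball 0 R \<times> {0<..<T1}. Z (x, t) \<le> Z w)"
    proof (rule interior_negative_minimum[of 0 R T1 Z x1 t1])
      have "continuous_on (cball 0 R \<times> {0..T1}) v"
        using T1 by (intro continuous_on_subset[OF cont]) auto
      then show "continuous_on (cball 0 R \<times> {0..T1}) Z"
        unfolding Z_def by (intro continuous_intros)
      show "x1 \<in> cball 0 R" using B \<epsilon> by (simp add: R_def)
      show "t1 \<in> {0..T1}" using t1 T1 by auto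
      show "Z (x1, t1) < 0" using \<epsilon>1 by (simp add: Z_def a_def algebra_simps)
      fix x :: "real ^ 'n" and t
      assume *: "dist 0 x \<le> R" "0 \<le> t" "t \<le> T1" "dist 0 x = R \<or> t = 0 \<or> t = T1"
      have e: "0 \<le> \<epsilon> * 1" "0 \<le> \<epsilon> * (norm x)\<^sup>2" "0 \<le> \<epsilon> * exp (m * (t - t1))" using \<epsilon> by auto
      have Zx: "Z (x, t) = exp (- \<Lambda> * t) * (v (x, t) - c) + (\<epsilon> * 1 + \<epsilon> * (norm x)\<^sup>2 + \<epsilon> * exp (m * (t - t1)))"
        by (simp add: Z_def distrib_left)
      have lx: "- B \<le> exp (- \<Lambda> * t) * (v (x, t) - c)" using * T1 by (intro low) auto
      from *(4) show "0 \<le> Z (x, t)"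
      proof (elim disjE)
        assume "dist 0 x = R"
        then have "B \<le> \<epsilon> * (norm x)\<^sup>2" using RB by simp
        then show ?thesis using Zx e lx by linarith
      next
        assume "t = 0"
        then have "0 \<le> exp (- \<Lambda> * t) * (v (x, t) - c)" using init[of x] by simp
        then show ?thesis using Zx e by linarith
      next
        assume "t = T1"
        then have "B \<le> \<epsilon> * exp (m * (t - t1))" using mB by simp
        then show ?thesis using Zx e lx by linarith
      qed
    qed
    then obtain x t where xt: "dist 0 x < R" "0 < t" "t < T1" "Z (x, t) < 0"
      "\<And>w. w \<in> ball 0 R \<times> {0<..<T1} \<Longrightarrow> Z (x, t) \<le> Z w" by blast
    define \<mu> where "\<mu> = - Z (x, t)"
    have \<mu>: "0 < \<mu>" using xt by (simp add: \<mu>_def)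
    \<comment> \<open>Solving Z = -\<mu> for \<open>v\<close> gives the barrier \<alpha> + \<beta>
      times the square of |x|; the shift by \<mu> makes it touch \<open>v\<close> exactly at the
      minimum of \<open>Z\<close>.\<close>
    define \<alpha> where "\<alpha> s = c - exp (\<Lambda> * s) * (\<epsilon> + \<epsilon> * exp (m * (s - t1)) + \<mu>)" for s
    define \<alpha>' where "\<alpha>' s = - \<Lambda> * exp (\<Lambda> * s) * (\<epsilon> + \<epsilon> * exp (m * (s - t1)) + \<mu>)
       - exp (\<Lambda> * s) * (\<epsilon> * m * exp (m * (s - t1)))" for s
    define \<alpha>'' where "\<alpha>'' s = - \<Lambda>\<^sup>2 * exp (\<Lambda> * s) * (\<epsilon> + \<epsilon> * exp (m * (s - t1)) + \<mu>)
       - 2 * \<Lambda> * exp (\<Lambda> * s) * (\<epsilon> * m * exp (m * (s - t1))) - exp (\<Lambda> * s) * (\<epsilon> * m\<^sup>2 * exp (m * (s - t1)))" for s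
    define \<beta> where "\<beta> s = - \<epsilon> * exp (\<Lambda> * s)" for s
    have test: "radial_test \<alpha> \<alpha>' \<alpha>'' \<beta> (\<lambda>s. \<Lambda> * \<beta> s) (\<lambda>s. \<Lambda>\<^sup>2 * \<beta> s) (\<lambda>r. r) (\<lambda>_. 1) (\<lambda>_. 0)"
      unfolding \<alpha>_def[abs_def] \<alpha>'_def[abs_def] \<alpha>''_def[abs_def] \<beta>_def[abs_def]
      by unfold_locales
        (auto simp: power2_eq_square algebra_simps intro!: derivative_eq_intros continuous_intros)
    have touch: "v w - (\<alpha> (snd w) + \<beta> (snd w) * (norm (fst w - 0))\<^sup>2) = exp (\<Lambda> * snd w) * (Z w + \<mu>)" for w
    proof -
      have "exp (\<Lambda> * snd w) * exp (- \<Lambda> * snd w) = 1" by (simp flip: exp_add)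
      then have "exp (\<Lambda> * snd w) * (exp (- \<Lambda> * snd w) * (v w - c)) = v w - c"
        by (metis mult.assoc mult_1)
      then show ?thesis unfolding Z_def \<alpha>_def \<beta>_def distrib_left by (simp add: algebra_simps)
    qed
    have "local_min_at (UNIV \<times> {0<..<T}) (\<lambda>w. v w - (\<alpha> (snd w) + \<beta> (snd w) * (norm (fst w - 0))\<^sup>2)) (x, t)"
    proof (rule local_min_atI[of "ball 0 R \<times> {0<..<T1}"])
      show "open (ball (0 :: real ^ 'n) R \<times> {0<..<T1})" by (intro open_Times) auto
      fix w :: "(real ^ 'n) \<times> real" assume "w \<in> ball 0 R \<times> {0<..<T1}"
      then have "0 \<le> Z w + \<mu>" using xt(5) by (simp add: \<mu>_def)
      then show "v (x, t) - (\<alpha> (snd (x, t)) + \<beta> (snd (x, t)) * (norm (fst (x, t) - 0))\<^sup>2)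
          \<le> v w - (\<alpha> (snd w) + \<beta> (snd w) * (norm (fst w - 0))\<^sup>2)"
        unfolding touch by (simp add: \<mu>_def)
    qed (use xt T1 in auto)
    from rad[unfolded radial_supersolution_def, rule_format, OF test this]
    have ineq: "\<beta> t * (2 * (n + p - 2)) \<le> \<alpha>' t + \<Lambda> * \<beta> t * (norm x)\<^sup>2
        + pow_two_minus p (2 * \<bar>\<beta> t\<bar> * norm x) * f (v (x, t))"
      using \<epsilon> by (simp add: \<beta>_def n_def)
    have tT: "t \<in> {0..T}" using xt T1 by auto
    define \<Psi> where "\<Psi> = exp (\<Lambda> * t) * (\<epsilon> + \<epsilon> * exp (m * (t - t1)) + \<mu> + \<epsilon> * (norm x)\<^sup>2)"
    have v: "v (x, t) - c = - \<Psi>"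
      using touch[of "(x, t)"] by (simp add: \<mu>_def \<alpha>_def \<beta>_def \<Psi>_def algebra_simps)
    have "exp (\<Lambda> * t) * \<epsilon> \<le> \<Psi>"
      unfolding \<Psi>_def using \<mu> \<epsilon> by (intro mult_left_mono) auto
    then have \<Psi>: "exp (\<Lambda> * t) * \<epsilon> \<le> \<Psi>" "0 \<le> \<Psi>" using \<epsilon> by (auto intro: order_trans[rotated])
    have "\<epsilon> * (norm x)\<^sup>2 \<le> B"
    proof -
      have "0 \<le> \<epsilon> * exp (m * (t - t1))" using \<epsilon> by simp
      moreover have "Z (x, t) = exp (- \<Lambda> * t) * (v (x, t) - c) + (\<epsilon> * 1 + \<epsilon> * (norm x)\<^sup>2 + \<epsilon> * exp (m * (t - t1)))"
        by (simp add: Z_def distrib_left)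
      ultimately show ?thesis using xt(4) low[OF tT, of x] \<epsilon> by linarith
    qed
    \<comment> \<open>Although |x| can be as large as the square root of B / \<epsilon>, the
      gradient is of order \<epsilon> |x| and hence at most of the order of the square root of
      \<epsilon> B.\<close>
    have "(2 * \<bar>\<beta> t\<bar> * norm x)\<^sup>2 = 4 * (exp (\<Lambda> * t))\<^sup>2 * (\<epsilon> * (\<epsilon> * (norm x)\<^sup>2))"
      by (simp add: \<beta>_def power_mult_distrib power2_eq_square)
    also have "(exp (\<Lambda> * t))\<^sup>2 = exp (2 * \<Lambda> * t)" by (simp add: power2_eq_square flip: exp_add)
    also have "4 * exp (2 * \<Lambda> * t) * (\<epsilon> * (\<epsilon> * (norm x)\<^sup>2)) \<le> 4 * exp (2 * \<Lambda> * T) * (\<epsilon> * B)"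
      using \<open>\<epsilon> * (norm x)\<^sup>2 \<le> B\<close> \<epsilon> tT \<Lambda> by (intro mult_mono mult_left_mono) (auto intro!: mult_left_mono)
    also note \<epsilon>2
    finally have "2 * \<bar>\<beta> t\<bar> * norm x \<le> 1" by (simp add: abs_square_le_1)
    then have N: "0 \<le> pow_two_minus p (2 * \<bar>\<beta> t\<bar> * norm x)" "pow_two_minus p (2 * \<bar>\<beta> t\<bar> * norm x) \<le> 1"
      using p by (auto intro!: pow_two_minus_bounds)
    have "\<bar>f (v (x, t))\<bar> \<le> K * \<Psi>" using fK[OF bnd[OF tT, of x]] v \<Psi> by simp
    then have "\<bar>pow_two_minus p (2 * \<bar>\<beta> t\<bar> * norm x) * f (v (x, t))\<bar> \<le> 1 * (K * \<Psi>)"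
      unfolding abs_mult using N by (intro mult_mono) auto
    then have "pow_two_minus p (2 * \<bar>\<beta> t\<bar> * norm x) * f (v (x, t)) \<le> K * \<Psi>" by simp
    moreover have "\<alpha>' t + \<Lambda> * \<beta> t * (norm x)\<^sup>2 = - \<Lambda> * \<Psi> - exp (\<Lambda> * t) * (\<epsilon> * m * exp (m * (t - t1)))"
      by (simp add: \<alpha>'_def \<beta>_def \<Psi>_def algebra_simps)
    moreover have "0 \<le> exp (\<Lambda> * t) * (\<epsilon> * m * exp (m * (t - t1)))" using \<epsilon> m by simp
    ultimately have "\<beta> t * (2 * (n + p - 2)) \<le> (K - \<Lambda>) * \<Psi>" using ineq by (simp add: algebra_simps)
    also have "\<dots> = - (2 * n + 1) * \<Psi>" by (simp add: \<Lambda>_def)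
    also have "\<dots> \<le> - (2 * n + 1) * (exp (\<Lambda> * t) * \<epsilon>)"
      using \<Psi> by (intro mult_left_mono_neg) (auto simp: n_def)
    finally have "(exp (\<Lambda> * t) * \<epsilon>) * (2 * n + 1 - 2 * (n + p - 2)) \<le> 0"
      by (simp add: \<beta>_def algebra_simps)
    moreover have "0 < (exp (\<Lambda> * t) * \<epsilon>) * (2 * n + 1 - 2 * (n + p - 2))"
      using \<epsilon> p by (intro mult_pos_pos) auto
    ultimately show False by linarith
  qed
  note interior = this
  have "0 \<le> v (x, t) - c"
    by (rule nonneg_at_closed_interval[of T "\<lambda>s. v (x, s) - c"])
      (intro continuous_intros continuous_on_time_slice[OF cont] T interior t; assumption)+
  then show ?thesis by simp
qed

text \<open>The initial gap is transported by a barrier that vanishes on the boundary of a small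
  ball, where v \<ge> c suffices, and that decays in time without reaching zero at the
  centre.\<close>

lemma radial_supersolution_strict_minimum:
  fixes v :: "(real ^ 'n) \<times> real \<Rightarrow> real"
  assumes p: "1 < p" "p \<le> 2" and T: "0 < T"
    and cont: "continuous_on (UNIV \<times> {0..T}) v"
    and bnd: "\<And>x t. t \<in> {0..T} \<Longrightarrow> \<bar>v (x, t) - c\<bar> \<le> B"
    and rad: "radial_supersolution p f T v"
    and fK: "\<And>r. \<bar>r - c\<bar> \<le> B \<Longrightarrow> \<bar>f r\<bar> \<le> K * \<bar>r - c\<bar>" and K: "0 \<le> K"
    and nonneg: "\<And>x t. t \<in> {0..T} \<Longrightarrow> c \<le> v (x, t)"
    and init: "c < v (x0, 0)" and t: "t \<in> {0..T}"
  shows "c < v (x0, t)"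
proof -
  define \<kappa> where "\<kappa> = (v (x0, 0) - c) / 2"
  have \<kappa>: "0 < \<kappa>" "c + \<kappa> < v (x0, 0)" using init by (auto simp: \<kappa>_def field_simps)
  obtain R where R: "0 < R" "R \<le> 1" "\<And>x. dist x0 x \<le> R \<Longrightarrow> c + \<kappa> \<le> v (x, 0)"
  proof -
    have "continuous_on UNIV (\<lambda>x. v (x, 0))"
      by (rule continuous_on_compose2[OF cont]) (use T in \<open>auto intro!: continuous_intros\<close>)
    then have "open {x. c + \<kappa> < v (x, 0)}" by (intro open_Collect_less) (auto intro!: continuous_intros)
    then obtain r where "0 < r" "cball x0 r \<subseteq> {x. c + \<kappa> < v (x, 0)}"
      using \<kappa>(2) open_contains_cball by (metis mem_Collect_eq)
    then show ?thesis by (intro that[of "min r 1"]) (auto simp: subset_eq less_imp_le)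
  qed
  define n where "n = real CARD('n)"
  have n: "1 \<le> n" by (simp add: n_def Suc_leI)
  \<comment> \<open>Since R \<le> 1 the barrier exceeds \<open>c\<close> by at most \<delta>: the
    bound \<kappa> places it below \<open>v\<close> at time 0, and 1/4 compensates the factor 4 in
    the norm of its gradient.\<close>
  define \<delta> where "\<delta> = min \<kappa> (1 / 4)"
  have \<delta>: "0 < \<delta>" "\<delta> \<le> \<kappa>" "4 * \<delta> \<le> 1" using \<kappa> by (auto simp: \<delta>_def)
  \<comment> \<open>With \<open>s = R\<^sup>2 - |x - x0|\<^sup>2\<close>, the barrier \<open>\<delta> * exp (- \<Lambda> * t) * s\<^sup>2\<close> is a strict subsolution on
    \<open>s > 0\<close> if \<open>a - b * s + (\<Lambda> - K) * s\<^sup>2 > 0\<close>, which the choice of \<open>\<Lambda>\<close> guarantees.\<close>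
  define b where "b = 8 * (p - 1) + 4 * (n + p - 2)"
  define a where "a = 8 * (p - 1) * R\<^sup>2"
  have a: "0 < a" using p R by (simp add: a_def)
  define \<Lambda> where "\<Lambda> = K + b\<^sup>2 / a"
  have \<Lambda>: "0 \<le> \<Lambda>" using K a by (simp add: \<Lambda>_def)
  have sq: "(R\<^sup>2 - r)\<^sup>2 \<le> 1" if "0 \<le> r" "r \<le> R\<^sup>2" for r
  proof -
    have "R\<^sup>2 \<le> 1" using R by (simp add: power_le_one)
    then have "\<bar>R\<^sup>2 - r\<bar> \<le> 1" using that by auto
    then show ?thesis by (simp add: abs_square_le_1)
  qed
  have "0 \<le> v (x0, t1) - (c + \<delta> * exp (- \<Lambda> * t1) * (R\<^sup>2)\<^sup>2)" if t1: "0 < t1" "t1 < T" for t1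
  proof (rule ccontr)
    assume "\<not> ?thesis"
    define d where "d = \<delta> * exp (- \<Lambda> * t1) * (R\<^sup>2)\<^sup>2 - (v (x0, t1) - c)"
    have d: "0 < d" using \<open>\<not> _\<close> by (simp add: d_def)
    \<comment> \<open>The penalty equals \<eta> < d at time \<open>t1\<close>, which leaves
      \<open>Z\<close> negative at (x0, t1); the exponent \<open>m\<close> then raises it to at
      least \<delta>, the largest possible height of the barrier, by time \<open>T1\<close>.\<close>
    define \<eta> where "\<eta> = d / 2"
    have \<eta>: "0 < \<eta>" "\<eta> < d" using d by (auto simp: \<eta>_def)
    define T1 where "T1 = (t1 + T) / 2"
    have T1: "t1 < T1" "T1 < T" using t1 by (auto simp: T1_def)
    define m where "m = \<delta> / (\<eta> * (T1 - t1))"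
    have m: "0 \<le> m" using \<delta> \<eta> T1 by (simp add: m_def)
    have "\<delta> = \<eta> * (m * (T1 - t1))" using \<eta> T1 by (simp add: m_def)
    also have "\<dots> \<le> \<eta> * exp (m * (T1 - t1))"
      using \<eta> exp_ge_add_one_self[of "m * (T1 - t1)"] by (intro mult_left_mono; linarith)
    finally have m\<delta>: "\<delta> \<le> \<eta> * exp (m * (T1 - t1))" .
    define Z where "Z z = v z - c - \<delta> * exp (- \<Lambda> * snd z) * (R\<^sup>2 - (norm (fst z - x0))\<^sup>2)\<^sup>2
        + \<eta> * exp (m * (snd z - t1))" for z
    have "\<exists>x t. dist x0 x < R \<and> 0 < t \<and> t < T1 \<and> Z (x, t) < 0 \<and>
      (\<forall>w\<in>ball x0 R \<times> {0<..<T1}. Z (x, t) \<le> Z w)"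
    proof (rule interior_negative_minimum[of x0 R T1 Z x0 t1])
      have "continuous_on (cball x0 R \<times> {0..T1}) v"
        using T1 by (intro continuous_on_subset[OF cont]) auto
      then show "continuous_on (cball x0 R \<times> {0..T1}) Z"
        unfolding Z_def by (intro continuous_intros)
      show "x0 \<in> cball x0 R" using R by simp
      show "t1 \<in> {0..T1}" using t1 T1 by auto
      show "Z (x0, t1) < 0" using \<eta> by (simp add: Z_def d_def)
      fix x :: "real ^ 'n" and t
      assume *: "dist x0 x \<le> R" "0 \<le> t" "t \<le> T1" "dist x0 x = R \<or> t = 0 \<or> t = T1"
      have nx: "norm (x - x0) \<le> R" using *(1) by (simp add: dist_norm norm_minus_commute)
      have e: "0 \<le> \<eta> * exp (m * (t - t1))" using \<eta> by auto
      have v0: "c \<le> v (x, t)" using nonneg[of t x] * T1 by auto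
      have "exp (- \<Lambda> * t) * (R\<^sup>2 - (norm (x - x0))\<^sup>2)\<^sup>2 \<le> 1 * 1"
        using * \<Lambda> nx by (intro mult_mono sq) (auto simp: power_mono)
      then have "\<delta> * (exp (- \<Lambda> * t) * (R\<^sup>2 - (norm (x - x0))\<^sup>2)\<^sup>2) \<le> \<delta> * 1"
        using \<delta> by (intro mult_left_mono) auto
      then have q: "\<delta> * exp (- \<Lambda> * t) * (R\<^sup>2 - (norm (x - x0))\<^sup>2)\<^sup>2 \<le> \<delta>" by (simp add: mult.assoc)
      have Zx: "Z (x, t) = v (x, t) - c - \<delta> * exp (- \<Lambda> * t) * (R\<^sup>2 - (norm (x - x0))\<^sup>2)\<^sup>2 + \<eta> * exp (m * (t - t1))"
        by (simp add: Z_def)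
      from *(4) show "0 \<le> Z (x, t)"
      proof (elim disjE)
        assume "dist x0 x = R"
        then have "norm (x - x0) = R" by (simp add: dist_norm norm_minus_commute)
        then show ?thesis using e v0 by (simp add: Z_def)
      next
        assume "t = 0"
        then have "c + \<kappa> \<le> v (x, t)" using R(3)[OF *(1)] by simp
        then show ?thesis using Zx e q \<delta> by linarith
      next
        assume "t = T1"
        then have "\<delta> \<le> \<eta> * exp (m * (t - t1))" using m\<delta> by simp
        then show ?thesis using Zx q v0 by linarith
      qed
    qed
    then obtain x t where xt: "dist x0 x < R" "0 < t" "t < T1" "Z (x, t) < 0"
      "\<And>w. w \<in> ball x0 R \<times> {0<..<T1} \<Longrightarrow> Z (x, t) \<le> Z w" by blast
    define \<mu> where "\<mu> = - Z (x, t)"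
    have \<mu>: "0 < \<mu>" using xt by (simp add: \<mu>_def)
    define \<beta> where "\<beta> s = \<delta> * exp (- \<Lambda> * s)" for s
    have test: "radial_test (\<lambda>s. c - \<eta> * exp (m * (s - t1)) - \<mu>) (\<lambda>s. - m * \<eta> * exp (m * (s - t1)))
        (\<lambda>s. - m\<^sup>2 * \<eta> * exp (m * (s - t1))) \<beta> (\<lambda>s. - \<Lambda> * \<beta> s) (\<lambda>s. \<Lambda>\<^sup>2 * \<beta> s)
        (\<lambda>r. (R\<^sup>2 - r)\<^sup>2) (\<lambda>r. - 2 * (R\<^sup>2 - r)) (\<lambda>_. 2)"
      unfolding \<beta>_def[abs_def]
      by unfold_locales
        (auto simp: power2_eq_square algebra_simps intro!: derivative_eq_intros continuous_intros)
    have touch: "v w - (c - \<eta> * exp (m * (snd w - t1)) - \<mu> + \<beta> (snd w) * (R\<^sup>2 - (norm (fst w - x0))\<^sup>2)\<^sup>2)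
        = Z w + \<mu>" for w
      by (simp add: Z_def \<beta>_def)
    have "local_min_at (UNIV \<times> {0<..<T}) (\<lambda>w. v w - (c - \<eta> * exp (m * (snd w - t1)) - \<mu>
        + \<beta> (snd w) * (R\<^sup>2 - (norm (fst w - x0))\<^sup>2)\<^sup>2)) (x, t)"
      unfolding touch
    proof (rule local_min_atI[of "ball x0 R \<times> {0<..<T1}"])
      show "open (ball x0 R \<times> {0<..<T1})" by (intro open_Times) auto
    qed (use xt T1 in auto)
    \<comment> \<open>The remaining premise asks that \<beta> and \<open>Q'\<close> do not vanish;
      it holds because the minimum lies in the open ball, where s > 0.\<close>
    note rule = rad[unfolded radial_supersolution_def, rule_format, OF test this]
    define \<rho> where "\<rho> = (norm (x - x0))\<^sup>2"
    define s where "s = R\<^sup>2 - \<rho>"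
    have nx: "norm (x - x0) < R" using xt(1) by (simp add: dist_norm norm_minus_commute)
    then have s: "0 < s" "s \<le> 1" "\<rho> = R\<^sup>2 - s"
      using R power_strict_mono[OF nx, of 2] power_le_one[of R 2] by (auto simp: s_def \<rho>_def intro: order_trans[rotated])
    have \<beta>: "0 < \<beta> t" "\<beta> t \<le> \<delta>"
      using \<delta> \<Lambda> xt by (auto simp: \<beta>_def mult_le_cancel_left1)
    have "\<beta> t * (4 * 2 * (p - 1) * \<rho> + 2 * (- 2 * s) * (n + p - 2))
       \<le> - m * \<eta> * exp (m * (t - t1)) + - \<Lambda> * \<beta> t * s\<^sup>2
         + pow_two_minus p (2 * \<bar>\<beta> t * (- 2 * s)\<bar> * norm (x - x0)) * f (v (x, t))"
      using rule \<beta> s unfolding \<rho>_def[symmetric] s_def[symmetric] n_def[symmetric] by simp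
    moreover have "0 \<le> m * \<eta> * exp (m * (t - t1))" using m \<eta> by simp
    moreover have "pow_two_minus p (2 * \<bar>\<beta> t * (- 2 * s)\<bar> * norm (x - x0)) * f (v (x, t)) \<le> K * (\<beta> t * s\<^sup>2)"
    proof -
      have tT: "t \<in> {0..T}" using xt T1 by auto
      have "2 * \<bar>\<beta> t * (- 2 * s)\<bar> * norm (x - x0) = 4 * (\<beta> t * s * norm (x - x0))"
        using \<beta> s by (simp add: abs_mult)
      also have "\<dots> \<le> 4 * (\<delta> * 1 * 1)"
        using \<beta> s nx R by (intro mult_left_mono mult_mono) auto
      also have "\<dots> \<le> 1" using \<delta> by simp
      finally have "2 * \<bar>\<beta> t * (- 2 * s)\<bar> * norm (x - x0) \<le> 1" .
      then have N: "0 \<le> pow_two_minus p (2 * \<bar>\<beta> t * (- 2 * s)\<bar> * norm (x - x0))"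
          "pow_two_minus p (2 * \<bar>\<beta> t * (- 2 * s)\<bar> * norm (x - x0)) \<le> 1"
        using p by (auto intro!: pow_two_minus_bounds)
      \<comment> \<open>Negativity of \<open>Z\<close> bounds v - c from above by the barrier, and v
        \<ge> c bounds it from below. The lower order term is therefore quadratic in
        \<open>s\<close>, of the same order as the term with \<Lambda>.\<close>
      have "v (x, t) - c \<le> \<beta> t * s\<^sup>2"
      proof -
        have "0 \<le> \<eta> * exp (m * (t - t1))" using \<eta> by simp
        then show ?thesis using xt(4) by (simp add: Z_def \<beta>_def s_def \<rho>_def)
      qed
      then have "K * \<bar>v (x, t) - c\<bar> \<le> K * (\<beta> t * s\<^sup>2)"
        using nonneg[OF tT, of x] K by (intro mult_left_mono) auto
      with fK[OF bnd[OF tT, of x]] have "\<bar>f (v (x, t))\<bar> \<le> K * (\<beta> t * s\<^sup>2)" by simp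
      then have "\<bar>pow_two_minus p (2 * \<bar>\<beta> t * (- 2 * s)\<bar> * norm (x - x0)) * f (v (x, t))\<bar> \<le> 1 * (K * (\<beta> t * s\<^sup>2))"
        unfolding abs_mult[of "pow_two_minus _ _"] using N by (intro mult_mono) auto
      then show ?thesis by simp
    qed
    ultimately have "\<beta> t * (4 * 2 * (p - 1) * \<rho> + 2 * (- 2 * s) * (n + p - 2)) \<le> \<beta> t * ((K - \<Lambda>) * s\<^sup>2)"
      by (simp add: algebra_simps)
    then have "4 * 2 * (p - 1) * \<rho> + 2 * (- 2 * s) * (n + p - 2) \<le> (K - \<Lambda>) * s\<^sup>2"
      using \<beta>(1) by (simp only: mult_le_cancel_left_pos)
    moreover have "4 * 2 * (p - 1) * \<rho> + 2 * (- 2 * s) * (n + p - 2) = a - b * s"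
      unfolding s(3) a_def b_def by algebra
    moreover have "(K - \<Lambda>) * s\<^sup>2 = - (b\<^sup>2 / a * s\<^sup>2)" by (simp add: \<Lambda>_def)
    ultimately have "a - b * s + b\<^sup>2 / a * s\<^sup>2 \<le> 0" by linarith
    \<comment> \<open>Multiplying by \<open>a\<close> clears the denominator, and completing the
      square leaves a strictly positive remainder.\<close>
    then have "a * (a - b * s + b\<^sup>2 / a * s\<^sup>2) \<le> 0" using a by (simp add: mult_le_0_iff)
    moreover have "a * (a - b * s + b\<^sup>2 / a * s\<^sup>2) = (b * s - a / 2)\<^sup>2 + 3 / 4 * a\<^sup>2"
    proof -
      have "a * (b\<^sup>2 / a * s\<^sup>2) = b\<^sup>2 * s\<^sup>2" using a by simp
      then have "a * (a - b * s + b\<^sup>2 / a * s\<^sup>2) = a\<^sup>2 - a * b * s + b\<^sup>2 * s\<^sup>2" by algebra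
      then show ?thesis by (simp add: power2_eq_square algebra_simps)
    qed
    moreover have "0 < (b * s - a / 2)\<^sup>2 + 3 / 4 * a\<^sup>2" using a by (intro add_nonneg_pos) auto
    ultimately show False by linarith
  qed
  note interior = this
  have "0 \<le> v (x0, t) - (c + \<delta> * exp (- \<Lambda> * t) * (R\<^sup>2)\<^sup>2)"
    by (rule nonneg_at_closed_interval[of T "\<lambda>s. v (x0, s) - (c + \<delta> * exp (- \<Lambda> * s) * (R\<^sup>2)\<^sup>2)"])
      (intro continuous_intros continuous_on_time_slice[OF cont] T interior t; assumption)+
  moreover have "0 < \<delta> * exp (- \<Lambda> * t) * (R\<^sup>2)\<^sup>2" using \<delta> R by simp
  ultimately show ?thesis by linarith
qed

section \<open>Constancy\<close>

text \<open>The zero \<open>c\<close> is a minimum of \<open>F\<close>, so the derivative vanishes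
  there. Comparing the second derivative with its value at \<open>c\<close> through the Hoelder
  condition bounds it near \<open>c\<close>, and two applications of the mean value inequality give
  the linear and quadratic bounds.\<close>

lemma C2_holder_loc_bounds_near_zero:
  assumes "C2_holder_loc \<beta> F" and "0 < \<beta>" and nonneg: "\<And>r. 0 \<le> F r" and "F c = 0" and "0 \<le> B"
  obtains K where "0 \<le> K" "\<And>r. \<bar>r - c\<bar> \<le> B \<Longrightarrow> \<bar>deriv F r\<bar> \<le> K * \<bar>r - c\<bar>"
    "\<And>r. \<bar>r - c\<bar> \<le> B \<Longrightarrow> F r \<le> K * (r - c)\<^sup>2"
proof -
  have F': "(F has_real_derivative deriv F r) (at r)" for r
    using assms(1) by (simp add: C2_holder_loc_def DERIV_deriv_iff_real_differentiable)
  have F'': "(deriv F has_real_derivative deriv (deriv F) r) (at r)" for r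
    using assms(1) by (simp add: C2_holder_loc_def DERIV_deriv_iff_real_differentiable)
  have f0: "deriv F c = 0"
    by (rule DERIV_local_min[OF F', of 1]) (use nonneg \<open>F c = 0\<close> in auto)
  define S where "S = {c - B..c + B}"
  have S: "r \<in> S \<longleftrightarrow> \<bar>r - c\<bar> \<le> B" for r by (auto simp: S_def)
  have "compact S" by (simp add: S_def)
  then have "\<exists>C. \<forall>r\<in>S. \<forall>s\<in>S. \<bar>deriv (deriv F) r - deriv (deriv F) s\<bar> \<le> C * \<bar>r - s\<bar> powr \<beta>"
    using assms(1) by (simp only: C2_holder_loc_def)
  then obtain C where C: "\<bar>deriv (deriv F) r - deriv (deriv F) s\<bar> \<le> C * \<bar>r - s\<bar> powr \<beta>"
    if "r \<in> S" "s \<in> S" for r s by blast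
  define K where "K = \<bar>deriv (deriv F) c\<bar> + \<bar>C\<bar> * B powr \<beta>"
  have K: "0 \<le> K" by (simp add: K_def)
  have K2: "\<bar>deriv (deriv F) r\<bar> \<le> K" if "r \<in> S" for r
  proof -
    have "\<bar>deriv (deriv F) r - deriv (deriv F) c\<bar> \<le> C * \<bar>r - c\<bar> powr \<beta>"
      using C[OF that, of c] S \<open>0 \<le> B\<close> by simp
    also have "\<dots> \<le> \<bar>C\<bar> * B powr \<beta>"
      using that S \<open>0 < \<beta>\<close> by (intro mult_mono powr_mono2) auto
    finally show ?thesis by (simp add: K_def)
  qed
  have f: "\<bar>deriv F r\<bar> \<le> K * \<bar>r - c\<bar>" if r: "\<bar>r - c\<bar> \<le> B" for r
  proof -
    have "norm (deriv F r - deriv F c) \<le> K * norm (r - c)"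
    proof (rule field_differentiable_bound)
      show "convex S" by (simp add: S_def)
      show "(deriv F has_field_derivative deriv (deriv F) z) (at z within S)" for z
        by (rule has_field_derivative_at_within[OF F''])
    qed (use K2 S r \<open>0 \<le> B\<close> in auto)
    then show ?thesis by (simp add: f0)
  qed
  have F2: "F r \<le> K * (r - c)\<^sup>2" if r: "\<bar>r - c\<bar> \<le> B" for r
  proof -
    \<comment> \<open>On the interval of radius |r - c|, rather than \<open>B\<close>, the
      derivative is at most K |r - c|, which is what makes the resulting bound quadratic.\<close>
    let ?I = "{c - \<bar>r - c\<bar>..c + \<bar>r - c\<bar>}"
    have "norm (F r - F c) \<le> (K * \<bar>r - c\<bar>) * norm (r - c)"
    proof (rule field_differentiable_bound)
      show "convex ?I" by simp
      show "(F has_field_derivative deriv F z) (at z within ?I)" for z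
        by (rule has_field_derivative_at_within[OF F'])
      fix z assume "z \<in> ?I"
      then have z: "\<bar>z - c\<bar> \<le> \<bar>r - c\<bar>" by auto
      have "\<bar>deriv F z\<bar> \<le> K * \<bar>z - c\<bar>" using f z r by auto
      also have "\<dots> \<le> K * \<bar>r - c\<bar>" using z K by (intro mult_left_mono)
      finally show "norm (deriv F z) \<le> K * \<bar>r - c\<bar>" by simp
    qed auto
    then show ?thesis using \<open>F c = 0\<close> by (simp add: power2_eq_square mult.assoc flip: abs_mult)
  qed
  show ?thesis by (rule that[OF K f F2])
qed

text \<open>From p \<le> 2 and y \<le> B, the square of \<open>y\<close> is at most B + 1 times its
  p-th power. The constant is at least 1, hence at most its own p-th power, so no root of it is
  needed; its summand 1 makes the contradiction strict.\<close>

lemma le_linear_of_powr_le_square: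
  fixes G y A B p :: real
  assumes "1 < p" "p \<le> 2" "0 \<le> G" "0 \<le> y" "y \<le> B" "0 \<le> A" and le: "G powr p \<le> A * y\<^sup>2"
  shows "G \<le> (A * (B + 1) + 1) * y"
proof (cases "y = 0")
  case True
  then have "G powr p = 0" using le by (intro antisym) auto
  then show ?thesis using True by simp
next
  case False
  then have y: "0 < y" using assms by simp
  define C where "C = A * (B + 1) + 1"
  have C: "1 \<le> C" using assms y by (simp add: C_def)
  show ?thesis
  proof (rule ccontr)
    assume "\<not> ?thesis"
    then have "C * y < G" by (simp add: C_def)
    then have "(C * y) powr p < G powr p" using C y \<open>1 < p\<close> by (intro powr_less_mono2) auto
    moreover have "C powr 1 * y powr p \<le> C powr p * y powr p"
      using C \<open>1 < p\<close> by (intro mult_right_mono powr_mono) auto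
    moreover have "(C * y) powr p = C powr p * y powr p" using C y by (simp add: powr_mult)
    moreover have "A * y\<^sup>2 \<le> A * (B + 1) * y powr p"
    proof -
      have "y\<^sup>2 = y powr (2 - p) * y powr p" using y by (simp flip: powr_add)
      also have "\<dots> \<le> (B + 1) powr 1 * y powr p"
      proof (intro mult_right_mono)
        have "y powr (2 - p) \<le> (B + 1) powr (2 - p)" using assms y by (intro powr_mono2) auto
        also have "\<dots> \<le> (B + 1) powr 1" using assms y by (intro powr_mono) auto
        finally show "y powr (2 - p) \<le> (B + 1) powr 1" .
      qed auto
      finally show ?thesis using assms y by (simp add: mult.assoc mult_left_mono)
    qed
    moreover have "A * (B + 1) * y powr p < C powr 1 * y powr p"
      using y C by (intro mult_strict_right_mono) (auto simp: C_def)
    ultimately show False using le by linarith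
  qed
qed

theorem theorem1p6:
  fixes p \<beta> q M M1 M2 T t0 :: real
    and F :: "real \<Rightarrow> real"
    and g :: "real ^ 'n \<Rightarrow> real"
    and u :: "(real ^ 'n) \<times> real \<Rightarrow> real"
    and x0 :: "real ^ 'n"
  assumes "1 < p" and "p \<le> 2"
    and "\<beta> > 0" and "C2_holder_loc \<beta> F" and "\<And>r. F r \<ge> 0"
    and "\<exists>L. L-lipschitz_on UNIV g"
    and "Linfty_norm lebesgue g < \<infinity>" and "Linfty_norm lebesgue (gradient g) < \<infinity>"
    and "ereal M = Linfty_norm lebesgue g"
    and "- q \<le> M1" and "M1 \<le> - M" and "M \<le> M2" and "M2 \<le> q"
    and "deriv F M1 \<le> 0" and "0 \<le> deriv F M2"
    and "AE x in lebesgue. norm (gradient g x) powr p \<le> p / (p - 1) * F (g x)"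
    and "T > 0"
    and "u \<in> class_H T"
    and "viscosity_solution p (deriv F) T u"
    and "\<And>x. u (x, 0) = g x"
    and "t0 \<in> {0..T}" and "F (u (x0, t0)) = 0"
  shows "(\<lambda>x. u (x, t0)) constant_on UNIV"
proof -
  note p = \<open>1 < p\<close> \<open>p \<le> 2\<close> and T = \<open>T > 0\<close> and t0 = \<open>t0 \<in> {0..T}\<close> and g = \<open>\<And>x. u (x, 0) = g x\<close>
  define c where "c = u (x0, t0)"
  have Fc: "F c = 0" using assms by (simp add: c_def)
  have cont: "continuous_on (UNIV \<times> {0..T}) u" using \<open>u \<in> class_H T\<close> by (simp add: class_H_def)
  have sub: "viscosity_subsolution p (deriv F) T u" and super: "viscosity_supersolution p (deriv F) T u"
    using \<open>viscosity_solution p (deriv F) T u\<close> by (auto simp: viscosity_solution_def)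
  have "bounded (u ` (UNIV \<times> {0<..<T}))" using sub by (simp add: viscosity_subsolution_def)
  then obtain b where "\<forall>x. \<forall>t\<in>{0<..<T}. \<bar>u (x, t)\<bar> \<le> b" by (auto simp: bounded_iff)
  then have b: "\<And>x t. t \<in> {0<..<T} \<Longrightarrow> \<bar>u (x, t)\<bar> \<le> b" by blast
  \<comment> \<open>The definition of a viscosity solution bounds \<open>u\<close> only on the open
    strip; continuity extends the bound to the initial and final times.\<close>
  have b': "\<bar>u (x, t)\<bar> \<le> b" if "t \<in> {0..T}" for x t
  proof -
    have "0 \<le> b - \<bar>u (x, t)\<bar>"
    proof (rule nonneg_at_closed_interval[of T "\<lambda>s. b - \<bar>u (x, s)\<bar>"])
      show "continuous_on {0..T} (\<lambda>s. b - \<bar>u (x, s)\<bar>)"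
        by (intro continuous_intros continuous_on_time_slice[OF cont])
    qed (use T b that in auto)
    then show ?thesis by simp
  qed
  define B where "B = b + \<bar>c\<bar>"
  have bnd: "\<bar>u (x, t) - c\<bar> \<le> B" if "t \<in> {0..T}" for x t
    using b'[OF that, of x] by (simp add: B_def)
  have B: "0 \<le> B" using bnd[OF t0, of x0] by (simp add: c_def)
  obtain K where K: "0 \<le> K" "\<And>r. \<bar>r - c\<bar> \<le> B \<Longrightarrow> \<bar>deriv F r\<bar> \<le> K * \<bar>r - c\<bar>"
    "\<And>r. \<bar>r - c\<bar> \<le> B \<Longrightarrow> F r \<le> K * (r - c)\<^sup>2"
    using C2_holder_loc_bounds_near_zero[OF \<open>C2_holder_loc \<beta> F\<close> \<open>\<beta> > 0\<close> assms(5) Fc B] by blast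
  have rad: "radial_supersolution p (deriv F) T u"
    by (rule viscosity_supersolution_imp_radial[OF super])
  have rad': "radial_supersolution p (\<lambda>r. - deriv F (- r)) T (\<lambda>z. - u z)"
    by (rule viscosity_subsolution_imp_radial[OF sub])
  have cont': "continuous_on (UNIV \<times> {0..T}) (\<lambda>z. - u z)" by (intro continuous_intros cont)
  have bnd': "\<bar>- u (x, t) - - c\<bar> \<le> B" if "t \<in> {0..T}" for x t using bnd[OF that, of x] by linarith
  have K': "\<bar>- deriv F (- r)\<bar> \<le> K * \<bar>r - - c\<bar>" if "\<bar>r - - c\<bar> \<le> B" for r
  proof -
    have "\<bar>- r - c\<bar> = \<bar>r - - c\<bar>" by linarith
    then show ?thesis using K(2)[of "- r"] that by simp
  qed
  have above: "c \<le> u (x, t)" if "\<And>x. c \<le> g x" "t \<in> {0..T}" for x t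
    by (rule radial_supersolution_weak_minimum[OF p T cont bnd rad K(2,1)]) (use that g in auto)
  have below: "- c \<le> - u (x, t)" if "\<And>x. g x \<le> c" "t \<in> {0..T}" for x t
    by (rule radial_supersolution_weak_minimum[OF p T cont' bnd' rad' K' K(1)]) (use that g in auto)
  obtain L where L: "L-lipschitz_on UNIV g" using assms(6) by blast
  show ?thesis
  proof (cases "\<exists>x1. g x1 = c")
    case True
    then obtain x1 where x1: "g x1 = c" by blast
    define A where "A = p / (p - 1) * K"
    have A: "0 \<le> A" using p K by (simp add: A_def)
    have "AE x in lebesgue. norm (gradient g x) \<le> (A * (B + 1) + 1) * \<bar>g x - c\<bar>"
      using assms(16)
    proof eventually_elim
      case (elim x)
      have gx: "\<bar>g x - c\<bar> \<le> B" using bnd[of 0 x] T by (simp add: g)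
      have "p / (p - 1) * F (g x) \<le> p / (p - 1) * (K * (g x - c)\<^sup>2)"
        using K(3)[OF gx] p by (intro mult_left_mono) auto
      then have "norm (gradient g x) powr p \<le> A * \<bar>g x - c\<bar>\<^sup>2"
        using elim by (simp add: A_def mult.assoc)
      then show ?case using gx A p by (intro le_linear_of_powr_le_square[of p]) auto
    qed
    then have gc: "g x = c" for x
      by (rule constant_if_gradient_le_deviation[OF L _ _ x1, rotated]) (use A B in simp)
    have "c \<le> u (x, t0)" "- c \<le> - u (x, t0)" for x
      by (rule above[OF _ t0] below[OF _ t0], simp add: gc)+
    then have "u (x, t0) = c" for x by (simp add: antisym)
    then show ?thesis by (auto simp: constant_on_def)
  next
    case False
    \<comment> \<open>As a continuous function that omits \<open>c\<close>, the datum lies entirely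
      on one side of \<open>c\<close>, which supplies the one-sided initial condition.\<close>
    have "connected (range g)"
      by (intro connected_continuous_image lipschitz_on_continuous_on[OF L] connected_UNIV)
    then have "c \<in> range g" if "g x \<le> c" "c \<le> g y" for x y
      using that by (rule connectedD_interval[OF _ rangeI rangeI])
    then have no_crossing: "\<not> (g x \<le> c \<and> c \<le> g y)" for x y using False by auto
    consider "c < g x0" | "g x0 < c" using False by fastforce
    then show ?thesis
    proof cases
      case 1
      then have "c \<le> g x" for x using no_crossing[of x x0] by linarith
      \<comment> \<open>Since \<open>c\<close> was defined as u (x0, t0), this is absurd and
        excludes the case.\<close>
      then have "c < u (x0, t0)"
        by (intro radial_supersolution_strict_minimum[OF p T cont bnd rad K(2,1) _ _ t0])
          (use above 1 g in auto)
      then show ?thesis by (simp add: c_def)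
    next
      case 2
      then have "g x \<le> c" for x using no_crossing[of x0 x] by linarith
      then have "- c < - u (x0, t0)"
        by (intro radial_supersolution_strict_minimum[OF p T cont' bnd' rad' K' K(1) _ _ t0])
          (use below 2 g in auto)
      then show ?thesis by (simp add: c_def)
    qed
  qed
qed

end
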